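(* Let $n\ge 3$, let $R=\mathbb{Z}\langle t_1,\ldots,t_k\rangle$, and let $\Gamma=St_n(R)$ be the Steinberg group of dimension $n$ over $R$. Suppose that $X$ is a CAT(0) space and that $H$ is a group acting by isometries on $X$ properly, co-compactly and faithfully. Then any homomorphism $\phi:\Gamma\to H$ has finite image.
   Context: $\mathbb{Z}\langle t_1,\ldots,t_k\rangle$ denotes the ring of polynomials with integer coefficients in the non-commuting variables $t_1,\ldots,t_k$ (the free associative unital ring). For a unital ring $R$, the Steinberg group $St_n(R)$ is the group generated by symbols $x_{i,j}(r)$, with $r\in R$ and $1\le i\neq j\le n$, subject to the relations: (1) $x_{i,j}(r_1)x_{i,j}(r_2)=x_{i,j}(r_1+r_2)$; (2) $[x_{i,j}(r_1),x_{j,k}(r_2)]=x_{i,k}(r_1r_2)$ for $i,j,k$ distinct; (3) $[x_{i,j}(r_1),x_{l,k}(r_2)]=1$ when $j\neq l$ and $i\ne k$. Here $[x,y]=x^{-1}y^{-1}xy$. The action of the discrete group $H$ on $X$ by isometries is (metrically) proper if for every $x\in X$ there is $r>0$ such that the set $\{g\in H : g\cdot B(x,r)\cap B(x,r)\neq\emptyset\}$ is finite, where $B(x,r)$ is the ball of radius $r$ centred at $x$. *)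

theory Defs
  imports "HOL-Analysis.Analysis" "HOL-Algebra.Algebra" "HOL-Library.Poly_Mapping"
begin

section \<open>The free associative ring\<close>

text \<open>
  Polynomials in non-commuting variables are the monoid algebra of the free monoid over the
  integers. The multiplication of \<open>Poly_Mapping\<close> is convolution with respect to an additively
  written, not necessarily commutative monoid; so concatenation of monomials is written \<open>+\<close> here.
\<close>

datatype monomial = Monomial (letters: "nat list")

instantiation monomial :: monoid_add
begin
definition zero_monomial :: monomial where "0 = Monomial []"
definition plus_monomial :: "monomial \<Rightarrow> monomial \<Rightarrow> monomial"
  where "u + v = Monomial (letters u @ letters v)"
instance
  by standard (auto simp: zero_monomial_def plus_monomial_def)
end

definition free_assoc_ring :: "nat \<Rightarrow> (monomial \<Rightarrow>\<^sub>0 int) ring"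
  where "free_assoc_ring k =
    \<lparr>carrier = {p. \<forall>w \<in> Poly_Mapping.keys p. set (letters w) \<subseteq> {1..k}},
     mult = (*), one = 1, ring.zero = 0, add = (+)\<rparr>"

lemma carrier_free_assoc_ring:
  "p \<in> carrier (free_assoc_ring k) \<longleftrightarrow> (\<forall>w \<in> Poly_Mapping.keys p. set (letters w) \<subseteq> {1..k})"
  by (simp add: free_assoc_ring_def)

lemma free_assoc_ring_sels:
  "x \<otimes>\<^bsub>free_assoc_ring k\<^esub> y = x * y" "x \<oplus>\<^bsub>free_assoc_ring k\<^esub> y = x + y"
  "\<one>\<^bsub>free_assoc_ring k\<^esub> = 1" "\<zero>\<^bsub>free_assoc_ring k\<^esub> = 0"
  by (simp_all add: free_assoc_ring_def)

lemma ring_free_assoc_ring: "ring (free_assoc_ring k)"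
proof -
  let ?C = "carrier (free_assoc_ring k)"
  have add: "p + q \<in> ?C" if "p \<in> ?C" "q \<in> ?C" for p q
    using that Poly_Mapping.keys_add[of p q] unfolding carrier_free_assoc_ring by blast
  have mult: "p * q \<in> ?C" if p: "p \<in> ?C" and q: "q \<in> ?C" for p q
    unfolding carrier_free_assoc_ring
  proof
    fix w assume "w \<in> Poly_Mapping.keys (p * q)"
    then obtain u v where "w = u + v" "u \<in> Poly_Mapping.keys p" "v \<in> Poly_Mapping.keys q"
      using keys_mult[of p q] by blast
    then show "set (letters w) \<subseteq> {1..k}"
      using p q by (simp add: carrier_free_assoc_ring plus_monomial_def)
  qed
  have one: "1 \<in> ?C" and zero: "0 \<in> ?C"
    by (simp_all add: carrier_free_assoc_ring zero_monomial_def)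
  have neg: "- p \<in> ?C" if "p \<in> ?C" for p
    using that by (simp add: carrier_free_assoc_ring)
  have "abelian_group (free_assoc_ring k)"
  proof (rule abelian_groupI, unfold free_assoc_ring_sels)
    show "\<exists>y\<in>?C. y + x = 0" if "x \<in> ?C" for x
      using neg[OF that] by (intro bexI[of _ "- x"]) simp_all
  qed (simp_all add: add zero add.assoc add.commute)
  moreover have "Group.monoid (free_assoc_ring k)"
    by (rule Group.monoidI, unfold free_assoc_ring_sels) (simp_all add: mult one mult.assoc)
  ultimately show ?thesis
    by (rule ringI, unfold free_assoc_ring_sels) (simp_all add: distrib_left distrib_right)
qed


section \<open>Groups given by generators and relations\<close>

text \<open>In a group word, \<open>(g, True)\<close> stands for the generator \<open>g\<close> and \<open>(g, False)\<close> for its inverse.\<close>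

type_synonym 'g gword = "('g \<times> bool) list"

definition gwords :: "'g set \<Rightarrow> 'g gword set"
  where "gwords S = lists (S \<times> UNIV)"

definition gen :: "'g \<Rightarrow> 'g gword"
  where "gen g = [(g, True)]"

definition gword_inv :: "'g gword \<Rightarrow> 'g gword"
  where "gword_inv w = rev (map (\<lambda>(g, b). (g, \<not> b)) w)"

definition gword_comm :: "'g gword \<Rightarrow> 'g gword \<Rightarrow> 'g gword"
  where "gword_comm u v = gword_inv u @ gword_inv v @ u @ v"

inductive pres_eq :: "'g set \<Rightarrow> ('g gword \<times> 'g gword) set \<Rightarrow> 'g gword \<Rightarrow> 'g gword \<Rightarrow> bool"
  for S :: "'g set" and Rel :: "('g gword \<times> 'g gword) set"
  where
    refl: "w \<in> gwords S \<Longrightarrow> pres_eq S Rel w w"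
  | sym: "pres_eq S Rel u v \<Longrightarrow> pres_eq S Rel v u"
  | trans: "pres_eq S Rel u v \<Longrightarrow> pres_eq S Rel v w \<Longrightarrow> pres_eq S Rel u w"
  | append: "pres_eq S Rel u u' \<Longrightarrow> pres_eq S Rel v v' \<Longrightarrow> pres_eq S Rel (u @ v) (u' @ v')"
  | cancel: "g \<in> S \<Longrightarrow> pres_eq S Rel [(g, b), (g, \<not> b)] []"
  | rel: "(u, v) \<in> Rel \<Longrightarrow> u \<in> gwords S \<Longrightarrow> v \<in> gwords S \<Longrightarrow> pres_eq S Rel u v"

definition pres_rel :: "'g set \<Rightarrow> ('g gword \<times> 'g gword) set \<Rightarrow> ('g gword \<times> 'g gword) set"
  where "pres_rel S Rel = {(u, v). pres_eq S Rel u v}"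

definition presented_group :: "'g set \<Rightarrow> ('g gword \<times> 'g gword) set \<Rightarrow> 'g gword set monoid"
  where "presented_group S Rel =
    \<lparr>carrier = gwords S // pres_rel S Rel,
     mult = (\<lambda>A B. \<Union>u \<in> A. \<Union>v \<in> B. pres_rel S Rel `` {u @ v}),
     one = pres_rel S Rel `` {[]}\<rparr>"

lemma gword_inv_closed: "w \<in> gwords S \<Longrightarrow> gword_inv w \<in> gwords S"
  by (fastforce simp: gwords_def gword_inv_def)

lemma append_gwords_iff: "u @ v \<in> gwords S \<longleftrightarrow> u \<in> gwords S \<and> v \<in> gwords S"
  by (auto simp: gwords_def)

lemma pres_eq_gwords: "pres_eq S Rel u v \<Longrightarrow> u \<in> gwords S \<and> v \<in> gwords S"
  by (induction rule: pres_eq.induct) (auto simp: gwords_def)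

lemma equiv_pres_rel: "equiv (gwords S) (pres_rel S Rel)"
proof (rule equivI)
  show "pres_rel S Rel \<subseteq> gwords S \<times> gwords S"
    using pres_eq_gwords by (auto simp: pres_rel_def)
  show "refl_on (gwords S) (pres_rel S Rel)"
    by (auto simp: refl_on_def pres_rel_def intro: pres_eq.refl)
  show "Relation.sym (pres_rel S Rel)"
    by (auto simp: Relation.sym_def pres_rel_def intro: pres_eq.sym)
  show "Relation.trans (pres_rel S Rel)"
    by (auto simp: Relation.trans_def pres_rel_def intro: pres_eq.trans)
qed

lemma pres_eq_inv_left: "w \<in> gwords S \<Longrightarrow> pres_eq S Rel (gword_inv w @ w) []"
proof (induction w)
  case Nil
  then show ?case
    by (simp add: gword_inv_def pres_eq.refl)
next
  case (Cons x w)
  obtain g b where x: "x = (g, b)" by force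
  have g: "g \<in> S" and w: "w \<in> gwords S"
    using Cons.prems by (auto simp: x gwords_def)
  note iw = gword_inv_closed[OF w]
  have c: "pres_eq S Rel [(g, \<not> b), (g, b)] []"
    using pres_eq.cancel[OF g, of Rel "\<not> b"] by simp
  have "pres_eq S Rel (gword_inv w @ [(g, \<not> b), (g, b)] @ w) (gword_inv w @ [] @ w)"
    by (intro pres_eq.append pres_eq.refl iw w c)
  then have "pres_eq S Rel (gword_inv w @ [(g, \<not> b), (g, b)] @ w) []"
    using Cons.IH[OF w] pres_eq.trans by fastforce
  then show ?case
    by (simp add: gword_inv_def x)
qed

lemma presented_group_mult:
  assumes "u \<in> gwords S" "v \<in> gwords S"
  shows "(pres_rel S Rel `` {u}) \<otimes>\<^bsub>presented_group S Rel\<^esub> (pres_rel S Rel `` {v})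
    = pres_rel S Rel `` {u @ v}"
proof -
  have "pres_rel S Rel `` {a @ b} = pres_rel S Rel `` {u @ v}"
    if "(u, a) \<in> pres_rel S Rel" "(v, b) \<in> pres_rel S Rel" for a b
  proof (rule equiv_class_eq[OF equiv_pres_rel])
    show "(a @ b, u @ v) \<in> pres_rel S Rel"
      using that by (auto simp: pres_rel_def intro: pres_eq.sym pres_eq.append)
  qed
  moreover have "(u, u) \<in> pres_rel S Rel" "(v, v) \<in> pres_rel S Rel"
    using assms by (auto simp: pres_rel_def intro: pres_eq.refl)
  ultimately have "(\<Union>a \<in> pres_rel S Rel `` {u}. \<Union>b \<in> pres_rel S Rel `` {v}. pres_rel S Rel `` {a @ b})
    = pres_rel S Rel `` {u @ v}"
    by blast
  then show ?thesis
    by (simp only: presented_group_def monoid.simps)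
qed

lemma group_presented_group: "group (presented_group S Rel)"
proof -
  let ?G = "presented_group S Rel"
  let ?c = "\<lambda>w. pres_rel S Rel `` {w}"
  have carr: "carrier ?G = ?c ` gwords S"
    by (auto simp: presented_group_def quotient_def)
  have one: "\<one>\<^bsub>?G\<^esub> = ?c []"
    by (simp add: presented_group_def)
  have nil: "[] \<in> gwords S"
    by (simp add: gwords_def)
  show ?thesis
  proof (rule groupI)
    fix x assume "x \<in> carrier ?G"
    then obtain u where u: "u \<in> gwords S" "x = ?c u"
      by (auto simp: carr)
    have "?c (gword_inv u @ u) = ?c []"
      using pres_eq_inv_left[OF u(1), of Rel]
      by (intro equiv_class_eq[OF equiv_pres_rel]) (simp add: pres_rel_def)
    then show "\<exists>y\<in>carrier ?G. y \<otimes>\<^bsub>?G\<^esub> x = \<one>\<^bsub>?G\<^esub>"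
      using u gword_inv_closed[OF u(1)]
      by (intro bexI[of _ "?c (gword_inv u)"]) (auto simp: presented_group_mult one carr)
  qed (use nil in \<open>auto simp: carr one presented_group_mult append_gwords_iff\<close>)
qed


section \<open>Steinberg groups\<close>

text \<open>The generator \<open>(i, j, r)\<close> is the symbol usually written as x with indices \<open>i\<close>, \<open>j\<close> and argument \<open>r\<close>.\<close>

definition steinberg_gens :: "nat \<Rightarrow> ('r, 'm) ring_scheme \<Rightarrow> (nat \<times> nat \<times> 'r) set"
  where "steinberg_gens n R = {(i, j, r). i \<in> {1..n} \<and> j \<in> {1..n} \<and> i \<noteq> j \<and> r \<in> carrier R}"

definition steinberg_rels ::
    "nat \<Rightarrow> ('r, 'm) ring_scheme \<Rightarrow> ((nat \<times> nat \<times> 'r) gword \<times> (nat \<times> nat \<times> 'r) gword) set"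
  where "steinberg_rels n R =
    {(gen (i, j, r) @ gen (i, j, s), gen (i, j, r \<oplus>\<^bsub>R\<^esub> s)) | i j r s.
       i \<in> {1..n} \<and> j \<in> {1..n} \<and> i \<noteq> j \<and> r \<in> carrier R \<and> s \<in> carrier R} \<union>
    {(gword_comm (gen (i, j, r)) (gen (j, k, s)), gen (i, k, r \<otimes>\<^bsub>R\<^esub> s)) | i j k r s.
       i \<in> {1..n} \<and> j \<in> {1..n} \<and> k \<in> {1..n} \<and> i \<noteq> j \<and> j \<noteq> k \<and> i \<noteq> k
       \<and> r \<in> carrier R \<and> s \<in> carrier R} \<union>
    {(gword_comm (gen (i, j, r)) (gen (l, k, s)), []) | i j l k r s.
       i \<in> {1..n} \<and> j \<in> {1..n} \<and> l \<in> {1..n} \<and> k \<in> {1..n} \<and> i \<noteq> j \<and> l \<noteq> k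
       \<and> j \<noteq> l \<and> i \<noteq> k \<and> r \<in> carrier R \<and> s \<in> carrier R}"

definition steinberg_group ::
    "nat \<Rightarrow> ('r, 'm) ring_scheme \<Rightarrow> (nat \<times> nat \<times> 'r) gword set monoid"
  where "steinberg_group n R = presented_group (steinberg_gens n R) (steinberg_rels n R)"

lemma group_steinberg_group: "group (steinberg_group n R)"
  by (simp add: steinberg_group_def group_presented_group)


section \<open>CAT(0) spaces\<close>

definition geodesic_segment :: "'x set \<Rightarrow> ('x \<Rightarrow> 'x \<Rightarrow> real) \<Rightarrow> 'x \<Rightarrow> 'x \<Rightarrow> 'x set \<Rightarrow> bool"
  where "geodesic_segment M d x y S \<longleftrightarrow>
    (\<exists>c. c \<in> {0..d x y} \<rightarrow> M \<and> c 0 = x \<and> c (d x y) = y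
       \<and> (\<forall>s\<in>{0..d x y}. \<forall>t\<in>{0..d x y}. d (c s) (c t) = \<bar>s - t\<bar>)
       \<and> S = c ` {0..d x y})"

definition comparison_point ::
    "('x \<Rightarrow> 'x \<Rightarrow> real) \<Rightarrow> 'x \<Rightarrow> real ^ 2 \<Rightarrow> real ^ 2 \<Rightarrow> 'x \<Rightarrow> real ^ 2 \<Rightarrow> bool"
  where "comparison_point d x x' y' p p' \<longleftrightarrow> p' \<in> closed_segment x' y' \<and> dist x' p' = d x p"

text \<open>
  \<open>A\<close>, \<open>B\<close>, \<open>C\<close> are the sides opposite to the vertices \<open>a\<close>, \<open>b\<close>, \<open>c\<close>, and \<open>a'\<close>, \<open>b'\<close>, \<open>c'\<close> are the
  vertices of a comparison triangle in the Euclidean plane.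
\<close>

definition CAT0_triangle ::
    "('x \<Rightarrow> 'x \<Rightarrow> real) \<Rightarrow> 'x \<Rightarrow> 'x \<Rightarrow> 'x \<Rightarrow> 'x set \<Rightarrow> 'x set \<Rightarrow> 'x set \<Rightarrow> bool"
  where "CAT0_triangle d a b c A B C \<longleftrightarrow>
    (\<forall>a' b' c'. dist a' b' = d a b \<and> dist b' c' = d b c \<and> dist c' a' = d c a \<longrightarrow>
      (let sides = {(a, a', b', C), (b, b', c', A), (c, c', a', B)} in
        \<forall>(x, x', y', S) \<in> sides. \<forall>(u, u', v', T) \<in> sides. \<forall>p\<in>S. \<forall>q\<in>T. \<forall>p' q'.
          comparison_point d x x' y' p p' \<and> comparison_point d u u' v' q q' \<longrightarrow>
          d p q \<le> dist p' q'))"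

definition CAT0_space :: "'x set \<Rightarrow> ('x \<Rightarrow> 'x \<Rightarrow> real) \<Rightarrow> bool"
  where "CAT0_space M d \<longleftrightarrow>
    Metric_space M d \<and>
    (\<forall>x\<in>M. \<forall>y\<in>M. \<exists>S. geodesic_segment M d x y S) \<and>
    (\<forall>a\<in>M. \<forall>b\<in>M. \<forall>c\<in>M. \<forall>A B C.
       geodesic_segment M d b c A \<and> geodesic_segment M d c a B \<and> geodesic_segment M d a b C \<longrightarrow>
       CAT0_triangle d a b c A B C)"


section \<open>Isometric, proper and cocompact actions\<close>

definition isometric_action ::
    "('h, 'm) monoid_scheme \<Rightarrow> 'x set \<Rightarrow> ('x \<Rightarrow> 'x \<Rightarrow> real) \<Rightarrow> ('h \<Rightarrow> 'x \<Rightarrow> 'x) \<Rightarrow> bool"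
  where "isometric_action H M d \<alpha> \<longleftrightarrow>
    group_action H M \<alpha> \<and>
    (\<forall>g\<in>carrier H. \<forall>x\<in>M. \<forall>y\<in>M. d (\<alpha> g x) (\<alpha> g y) = d x y)"

definition proper_action ::
    "('h, 'm) monoid_scheme \<Rightarrow> 'x set \<Rightarrow> ('x \<Rightarrow> 'x \<Rightarrow> real) \<Rightarrow> ('h \<Rightarrow> 'x \<Rightarrow> 'x) \<Rightarrow> bool"
  where "proper_action H M d \<alpha> \<longleftrightarrow>
    (\<forall>x\<in>M. \<exists>r>0. finite {g \<in> carrier H.
       \<alpha> g ` Metric_space.mball M d x r \<inter> Metric_space.mball M d x r \<noteq> {}})"

definition cocompact_action ::
    "('h, 'm) monoid_scheme \<Rightarrow> 'x set \<Rightarrow> ('x \<Rightarrow> 'x \<Rightarrow> real) \<Rightarrow> ('h \<Rightarrow> 'x \<Rightarrow> 'x) \<Rightarrow> bool"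
  where "cocompact_action H M d \<alpha> \<longleftrightarrow>
    (\<exists>K. compactin (Metric_space.mtopology M d) K \<and> (\<Union>g\<in>carrier H. \<alpha> g ` K) = M)"

end

theory Submission
  imports Defs
begin

text \<open>
  Write \<open>[x, y]\<close> for \<open>x\<inverse>y\<inverse>xy\<close> and \<open>U\<^bsub>ij\<^esub>\<close> for the image in \<open>H\<close> of the root subgroup with indices
  \<open>i\<close>, \<open>j\<close>. Every \<open>c\<close> in \<open>U\<^bsub>ik\<^esub>\<close> is a commutator \<open>[a, b]\<close> with which \<open>a\<close> and \<open>b\<close> commute, so
  \<open>c\<close> to the power \<open>m\<^sup>2\<close> equals \<open>[a\<^sup>m, b\<^sup>m]\<close> and \<open>c\<close> has translation length zero; properness and
  cocompactness then give \<open>c\<close> finite order. The orders of the finite subgroups of \<open>H\<close> are bounded,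
  hence the abelian torsion groups \<open>U\<^bsub>ij\<^esub>\<close> are finite.

  The rest is group theory. The group \<open>L\<close> generated by the \<open>U\<^bsub>ij\<^esub>\<close> with \<open>i, j \<noteq> p\<close> acts by conjugation
  on the two finite groups generated by the \<open>U\<^bsub>ip\<^esub>\<close> and by the \<open>U\<^bsub>pi\<^esub>\<close>, with central kernel; so \<open>L\<close> is
  centre-by-finite and generated by finitely many torsion elements, hence finite by Dietzmann's
  lemma. For \<open>p = 1\<close> and \<open>p = n\<close>, Tavgen's trick turns this into the stability under \<open>L\<close> of a fixed
  power of (upper unitriangular) (lower unitriangular), so this finite set is the whole image.
\<close>

section \<open>Dietzmann's lemma\<close>

context group
begin

text \<open>Right conjugation fits the commutator convention: \<open>conj_by b a\<close> is
  \<open>a\<close> times the commutator of \<open>a\<close> and \<open>b\<close>, and conjugating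
  first by \<open>g\<close>, then by \<open>h\<close>, is conjugating by
  \<open>g \<otimes> h\<close>.\<close>

definition conj_by :: "'a \<Rightarrow> 'a \<Rightarrow> 'a"
  where "conj_by g x = inv g \<otimes> x \<otimes> g"

lemma conj_by_closed [simp]:
  "g \<in> carrier G \<Longrightarrow> x \<in> carrier G \<Longrightarrow> conj_by g x \<in> carrier G"
  by (simp add: conj_by_def)

text \<open>With \<open>m_assoc\<close> and \<open>inv_mult_group\<close> as rewrite rules, these
  complete free reduction, so identities between group words fall to \<open>simp\<close>.\<close>

lemma inv_mult_cancel [simp]:
  assumes "x \<in> carrier G" "y \<in> carrier G"
  shows "inv x \<otimes> (x \<otimes> y) = y" "x \<otimes> (inv x \<otimes> y) = y"
  using assms by (simp_all flip: m_assoc)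

lemma mult_conj_by:
  "g \<in> carrier G \<Longrightarrow> x \<in> carrier G \<Longrightarrow> g \<otimes> conj_by g x = x \<otimes> g"
  by (simp add: conj_by_def m_assoc)

lemma conj_by_mult:
  "g \<in> carrier G \<Longrightarrow> x \<in> carrier G \<Longrightarrow> y \<in> carrier G \<Longrightarrow>
    conj_by g (x \<otimes> y) = conj_by g x \<otimes> conj_by g y"
  by (simp add: conj_by_def m_assoc)

lemma conj_by_inv:
  "g \<in> carrier G \<Longrightarrow> x \<in> carrier G \<Longrightarrow> conj_by g (inv x) = inv (conj_by g x)"
  by (simp add: conj_by_def m_assoc inv_mult_group)

lemma conj_by_conj_by:
  "g \<in> carrier G \<Longrightarrow> h \<in> carrier G \<Longrightarrow> x \<in> carrier G \<Longrightarrow>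
    conj_by h (conj_by g x) = conj_by (g \<otimes> h) x"
  by (simp add: conj_by_def m_assoc inv_mult_group)

lemma conj_by_one [simp]: "x \<in> carrier G \<Longrightarrow> conj_by \<one> x = x"
  by (simp add: conj_by_def)

lemma one_conj_by [simp]: "x \<in> carrier G \<Longrightarrow> conj_by x \<one> = \<one>"
  by (simp add: conj_by_def)

lemma conj_by_eq_iff_commute:
  "g \<in> carrier G \<Longrightarrow> x \<in> carrier G \<Longrightarrow> conj_by g x = x \<longleftrightarrow> g \<otimes> x = x \<otimes> g"
  by (metis conj_by_closed l_cancel mult_conj_by)

lemma conj_by_pow:
  fixes m :: nat
  shows "g \<in> carrier G \<Longrightarrow> x \<in> carrier G \<Longrightarrow> conj_by g (x [^] m) = conj_by g x [^] m"
  by (induction m) (simp_all add: conj_by_mult)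

section \<open>Collecting repeated factors of a product\<close>

definition list_prod :: "'a list \<Rightarrow> 'a"
  where "list_prod xs = foldr (\<otimes>) xs \<one>"

lemma list_prod_simps [simp]:
  "list_prod [] = \<one>" "list_prod (x # xs) = x \<otimes> list_prod xs"
  by (simp_all add: list_prod_def)

lemma list_prod_closed [simp]: "set xs \<subseteq> carrier G \<Longrightarrow> list_prod xs \<in> carrier G"
  by (induction xs) auto

lemma list_prod_append:
  "set xs \<subseteq> carrier G \<Longrightarrow> set ys \<subseteq> carrier G \<Longrightarrow>
    list_prod (xs @ ys) = list_prod xs \<otimes> list_prod ys"
  by (induction xs) (auto simp: m_assoc)

lemma list_prod_replicate: "x \<in> carrier G \<Longrightarrow> list_prod (replicate m x) = x [^] m"
  by (induction m) (simp, metis list_prod_simps(2) nat_pow_Suc2 replicate_Suc)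

text \<open>Since \<open>x \<otimes> s = s \<otimes> conj_by s x\<close>, the first occurrence of
  \<open>s\<close> can be pulled to the front. The factors it passes are conjugated but stay in
  \<open>S\<close>; the later occurrences of \<open>s\<close> are untouched, so the count drops by
  at most one.\<close>

lemma list_prod_extract:
  assumes "S \<subseteq> carrier G" and "\<And>s t. s \<in> S \<Longrightarrow> t \<in> S \<Longrightarrow> conj_by s t \<in> S"
    and "set xs \<subseteq> S" and "s \<in> set xs"
  shows "\<exists>ys. set ys \<subseteq> S \<and> length xs = Suc (length ys) \<and>
    count_list xs s \<le> Suc (count_list ys s) \<and> list_prod xs = s \<otimes> list_prod ys"
  using assms(3,4)
proof (induction xs)
  case (Cons x xs)
  show ?case
  proof (cases "x = s")
    case True
    then show ?thesis
      using Cons.prems by (intro exI[of _ xs]) auto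
  next
    case False
    then obtain ys where ys: "set ys \<subseteq> S" "length xs = Suc (length ys)"
      "count_list xs s \<le> Suc (count_list ys s)" "list_prod xs = s \<otimes> list_prod ys"
      using Cons by auto
    have carr: "x \<in> carrier G" "s \<in> carrier G" "set ys \<subseteq> carrier G" "x \<in> S" "s \<in> S"
      using Cons.prems assms(1) ys(1) by auto
    then have "x \<otimes> (s \<otimes> list_prod ys) = s \<otimes> (conj_by s x \<otimes> list_prod ys)"
      by (simp add: mult_conj_by flip: m_assoc)
    then show ?thesis
      using ys False carr assms(2) by (intro exI[of _ "conj_by s x # ys"]) auto
  qed
qed simp

lemma list_prod_extract_pow:
  assumes S: "S \<subseteq> carrier G" and conj: "\<And>s t. s \<in> S \<Longrightarrow> t \<in> S \<Longrightarrow> conj_by s t \<in> S"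
    and "set xs \<subseteq> S" and "m \<le> count_list xs s" and "s \<in> S"
  shows "\<exists>ys. set ys \<subseteq> S \<and> length xs = m + length ys \<and> list_prod xs = s [^] m \<otimes> list_prod ys"
  using assms(3,4)
proof (induction m arbitrary: xs)
  case 0
  then show ?case
    using S by (intro exI[of _ xs]) (auto simp: subset_trans)
next
  case (Suc m)
  then have "s \<in> set xs"
    by (metis count_notin not_less_eq_eq zero_le)
  from list_prod_extract[OF S conj Suc.prems(1) this]
  obtain ys where ys: "set ys \<subseteq> S" "length xs = Suc (length ys)"
    "count_list xs s \<le> Suc (count_list ys s)" "list_prod xs = s \<otimes> list_prod ys"
    by blast
  moreover from ys Suc.prems have "m \<le> count_list ys s"
    by simp
  ultimately obtain zs where zs: "set zs \<subseteq> S" "length ys = m + length zs"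
    "list_prod ys = s [^] m \<otimes> list_prod zs"
    using Suc.IH by blast
  have "s \<in> carrier G" "list_prod zs \<in> carrier G"
    using S \<open>s \<in> S\<close> zs(1) by (auto intro: list_prod_closed)
  then have "list_prod xs = s [^] Suc m \<otimes> list_prod zs"
    using ys(4) zs(3) by (metis m_assoc nat_pow_Suc2 nat_pow_closed)
  then show ?case
    using ys zs by (intro exI[of _ zs]) auto
qed

text \<open>For a common exponent \<open>m\<close>, a product of more than \<open>card S * m\<close>
  factors repeats some \<open>s\<close> at least \<open>m\<close> times by pigeonhole. Collected at
  the front, \<open>m\<close> copies cancel, so products of bounded length exhaust the
  group.\<close>

lemma generate_finite_torsion_conj_closed:
  assumes S: "S \<subseteq> carrier G" and fin: "finite S"
    and conj: "\<And>s t. s \<in> S \<Longrightarrow> t \<in> S \<Longrightarrow> conj_by s t \<in> S"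
    and tors: "\<And>s. s \<in> S \<Longrightarrow> \<exists>m>0. s [^] (m::nat) = \<one>"
  shows "finite (generate G S)"
proof -
  obtain f :: "'a \<Rightarrow> nat" where f: "f s > 0" "s [^] f s = \<one>" if "s \<in> S" for s
    using tors by metis
  \<comment> \<open>The product of exponents of the finitely many elements is an exponent for all of
    them.\<close>
  define m where "m = prod f S"
  have m: "m > 0"
    using f(1) by (simp add: m_def prod_pos)
  have pow_m: "s [^] m = \<one>" if s: "s \<in> S" for s
  proof -
    have "m = f s * prod f (S - {s})"
      unfolding m_def using s fin by (simp add: prod.remove)
    then show ?thesis
      using f(2)[OF s] s S by (metis nat_pow_one nat_pow_pow subsetD)
  qed
  define P where "P = list_prod ` {xs. set xs \<subseteq> S \<and> length xs \<le> card S * m}"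
  have short: "list_prod xs \<in> P" if "set xs \<subseteq> S" for xs
    using that
  proof (induction "length xs" arbitrary: xs rule: less_induct)
    case less
    show ?case
    proof (cases "length xs \<le> card S * m")
      case True
      then show ?thesis
        using less.prems by (auto simp: P_def)
    next
      case False
      have "\<exists>s\<in>S. m \<le> count_list xs s"
      proof (rule ccontr)
        assume "\<not> (\<exists>s\<in>S. m \<le> count_list xs s)"
        then have "sum (count_list xs) S \<le> card S * m"
          using sum_bounded_above[of S "count_list xs" m] by force
        then show False
          using False sum_count_set[OF less.prems fin] by simp
      qed
      then obtain s where s: "s \<in> S" "m \<le> count_list xs s" ..
      obtain ys where ys: "set ys \<subseteq> S" "length xs = m + length ys"
        "list_prod xs = s [^] m \<otimes> list_prod ys"
        using list_prod_extract_pow[OF S conj less.prems s(2,1)] by blast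
      have "list_prod ys \<in> carrier G"
        using S ys(1) by (intro list_prod_closed) auto
      then show ?thesis
        using less.hyps[of ys] ys m pow_m[OF s(1)] by simp
    qed
  qed
  have "generate G S \<subseteq> P"
  proof
    fix g assume "g \<in> generate G S"
    then have "\<exists>xs. set xs \<subseteq> S \<and> g = list_prod xs"
    proof (induction rule: generate.induct)
      case one
      then show ?case
        by (intro exI[of _ "[]"]) simp
    next
      case (incl h)
      then show ?case
        using S by (intro exI[of _ "[h]"]) auto
    next
      case (inv h)
      then have h: "h \<in> carrier G"
        using S by auto
      \<comment> \<open>Inverses are nonnegative powers, so products of elements of \<open>S\<close>
        alone suffice.\<close>
      have "inv h = h [^] (m - 1)"
        by (rule inv_equality)
          (use h m pow_m[OF inv] in \<open>simp_all flip: nat_pow_Suc\<close>)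
      then show ?case
        using inv h by (intro exI[of _ "replicate (m - 1) h"]) (auto simp: list_prod_replicate)
    next
      case (eng g h)
      then obtain xs ys where *: "set xs \<subseteq> S" "g = list_prod xs" "set ys \<subseteq> S" "h = list_prod ys"
        by blast
      then show ?case
        using S by (intro exI[of _ "xs @ ys"]) (auto simp: list_prod_append)
    qed
    then show "g \<in> P"
      using short by auto
  qed
  moreover have "finite P"
    unfolding P_def by (intro finite_imageI finite_lists_length_le fin)
  ultimately show ?thesis
    by (rule finite_subset)
qed

lemma finite_subgroup_torsion:
  assumes "subgroup K G" "finite K" "x \<in> K"
  shows "\<exists>m>0. x [^] (m::nat) = \<one>"
proof -
  interpret K: group "G\<lparr>carrier := K\<rparr>"
    by (rule subgroup.subgroup_is_group[OF assms(1) group_axioms])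
  have "x [^]\<^bsub>G\<lparr>carrier := K\<rparr>\<^esub> order (G\<lparr>carrier := K\<rparr>) = \<one>"
    using K.pow_order_eq_1 assms by simp
  moreover have "order (G\<lparr>carrier := K\<rparr>) > 0"
    using assms by (auto simp: order_def card_gt_0_iff)
  ultimately show ?thesis
    by (metis nat_pow_consistent)
qed

text \<open>An infinite \<open>U\<close> contains \<open>Suc B\<close> elements. Conjugation in
  \<open>U\<close> is trivial, so by Dietzmann's lemma they generate a finite subgroup, which is too
  large for the bound.\<close>

lemma torsion_abelian_finite:
  assumes U: "subgroup U G" and comm: "\<And>x y. x \<in> U \<Longrightarrow> y \<in> U \<Longrightarrow> x \<otimes> y = y \<otimes> x"
    and tors: "\<And>x. x \<in> U \<Longrightarrow> \<exists>m>0. x [^] (m::nat) = \<one>"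
    and bound: "\<And>F. subgroup F G \<Longrightarrow> finite F \<Longrightarrow> card F \<le> B"
  shows "finite U"
proof (rule ccontr)
  assume "infinite U"
  then obtain S where S: "S \<subseteq> U" "finite S" "card S = Suc B"
    using infinite_arbitrarily_large by blast
  have SG: "S \<subseteq> carrier G"
    using S(1) U subgroup.subset by blast
  have "conj_by s t = t" if "s \<in> S" "t \<in> S" for s t
    using that S(1) SG comm by (metis conj_by_eq_iff_commute subsetD)
  then have fin: "finite (generate G S)"
    using S tors by (intro generate_finite_torsion_conj_closed[OF SG]) auto
  have "Suc B \<le> card (generate G S)"
    using S(3) card_mono[OF fin, of S] by (auto intro: generate.incl)
  then show False
    using bound[OF generate_is_subgroup[OF SG] fin] by simp
qed

text \<open>Normalisation is checked on generators: conjugation by a fixed element is a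
  homomorphism, and conjugation by a product is iterated. Closure of \<open>A\<close> under inverses
  covers inverse letters, since \<open>conj_by a\<close> mapping a subgroup into itself says nothing
  about \<open>conj_by (inv a)\<close>.\<close>

lemma conj_by_generate:
  assumes A: "A \<subseteq> carrier G" and B: "B \<subseteq> carrier G" and inv: "\<And>a. a \<in> A \<Longrightarrow> inv a \<in> A"
    and ab: "\<And>a b. a \<in> A \<Longrightarrow> b \<in> B \<Longrightarrow> conj_by a b \<in> generate G B"
    and g: "g \<in> generate G A" and x: "x \<in> generate G B"
  shows "conj_by g x \<in> generate G B"
proof -
  note subB = generate_is_subgroup[OF B]
  have *: "conj_by a x \<in> generate G B" if a: "a \<in> A" and x: "x \<in> generate G B" for a x
    using x
  proof (induction rule: generate.induct)
    case one
    from a A have "a \<in> carrier G" ..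
    then show ?case
      by (simp add: generate.one)
  next
    case (incl b)
    then show ?case
      by (rule ab[OF a])
  next
    case (inv b)
    then have "conj_by a (inv b) = inv (conj_by a b)"
      using a A B by (intro conj_by_inv) auto
    then show ?case
      using subgroup.m_inv_closed[OF subB ab[OF a inv]] by simp
  next
    case (eng x y)
    then have "conj_by a (x \<otimes> y) = conj_by a x \<otimes> conj_by a y"
      using a A generate_in_carrier[OF B] by (intro conj_by_mult) auto
    then show ?case
      using generate.eng[OF eng.IH] by simp
  qed
  show ?thesis
    using g x
  proof (induction arbitrary: x rule: generate.induct)
    case one
    then show ?case
      using generate_in_carrier[OF B] by simp
  next
    case (incl a)
    then show ?case
      by (rule *)
  next
    case (inv a)
    show ?case
      by (rule *[OF assms(3)[OF inv.hyps] inv.prems])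
  next
    case (eng g h)
    have "conj_by (g \<otimes> h) x = conj_by h (conj_by g x)"
      using eng generate_in_carrier[OF A] generate_in_carrier[OF B]
      by (intro conj_by_conj_by[symmetric]) auto
    then show ?case
      using eng by simp
  qed
qed

end

section \<open>Groups generated by root subgroups\<close>

text \<open>The Steinberg relations with the ring forgotten. In the image of a Steinberg group,
  \<open>comm_ex\<close> reflects that each ring element is its product with the unit;
  \<open>commute\<close> for two equal index pairs makes each \<open>U i j\<close> abelian.\<close>

locale root_subgroups = group G for G (structure) +
  fixes n :: nat and U :: "nat \<Rightarrow> nat \<Rightarrow> 'a set"
  assumes n_ge_3: "n \<ge> 3"
    and subgroup_U: "\<lbrakk>i \<in> {1..n}; j \<in> {1..n}; i \<noteq> j\<rbrakk> \<Longrightarrow> subgroup (U i j) G"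
    and comm_mem: "\<lbrakk>i \<in> {1..n}; j \<in> {1..n}; k \<in> {1..n}; i \<noteq> j; j \<noteq> k; i \<noteq> k; a \<in> U i j; b \<in> U j k\<rbrakk>
      \<Longrightarrow> inv a \<otimes> inv b \<otimes> a \<otimes> b \<in> U i k"
    and comm_ex: "\<lbrakk>i \<in> {1..n}; j \<in> {1..n}; k \<in> {1..n}; i \<noteq> j; j \<noteq> k; i \<noteq> k; c \<in> U i k\<rbrakk>
      \<Longrightarrow> \<exists>a \<in> U i j. \<exists>b \<in> U j k. c = inv a \<otimes> inv b \<otimes> a \<otimes> b"
    and commute: "\<lbrakk>i \<in> {1..n}; j \<in> {1..n}; l \<in> {1..n}; k \<in> {1..n}; i \<noteq> j; l \<noteq> k; j \<noteq> l; i \<noteq> k;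
      a \<in> U i j; b \<in> U l k\<rbrakk> \<Longrightarrow> a \<otimes> b = b \<otimes> a"
begin

definition roots :: "(nat \<times> nat) set"
  where "roots = {(i, j). i \<in> {1..n} \<and> j \<in> {1..n} \<and> i \<noteq> j}"

definition elems :: "(nat \<times> nat) set \<Rightarrow> 'a set"
  where "elems P = (\<Union>(i, j)\<in>P. U i j)"

definition root_span :: "(nat \<times> nat) set \<Rightarrow> 'a set"
  where "root_span P = generate G (elems P)"

text \<open>In matrix terms, a Levi factor: the block of the indices other than \<open>p\<close>.
  Column \<open>p\<close> and row \<open>p\<close> give the unipotent radicals of the two opposite
  parabolics with this Levi factor.\<close>

definition levi_roots :: "nat \<Rightarrow> (nat \<times> nat) set"
  where "levi_roots p = {(i, j) \<in> roots. i \<noteq> p \<and> j \<noteq> p}"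

definition col_roots :: "nat \<Rightarrow> (nat \<times> nat) set"
  where "col_roots p = {(i, j) \<in> roots. j = p}"

definition row_roots :: "nat \<Rightarrow> (nat \<times> nat) set"
  where "row_roots p = {(i, j) \<in> roots. i = p}"

lemma subgroup_U': "(i, j) \<in> roots \<Longrightarrow> subgroup (U i j) G"
  by (simp add: roots_def subgroup_U)

lemma U_carrier: "(i, j) \<in> roots \<Longrightarrow> x \<in> U i j \<Longrightarrow> x \<in> carrier G"
  by (rule subgroup.mem_carrier[OF subgroup_U'])

lemma U_inv: "(i, j) \<in> roots \<Longrightarrow> x \<in> U i j \<Longrightarrow> inv x \<in> U i j"
  by (rule subgroup.m_inv_closed[OF subgroup_U'])

lemma root_sets: "levi_roots p \<subseteq> roots" "col_roots p \<subseteq> roots" "row_roots p \<subseteq> roots"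
  by (auto simp: levi_roots_def col_roots_def row_roots_def)

lemma finite_roots: "finite roots"
  by (rule finite_subset[of _ "{1..n} \<times> {1..n}"]) (auto simp: roots_def)

lemma elems_carrier: "P \<subseteq> roots \<Longrightarrow> elems P \<subseteq> carrier G"
  using U_carrier unfolding elems_def by blast

lemma elems_inv: "P \<subseteq> roots \<Longrightarrow> x \<in> elems P \<Longrightarrow> inv x \<in> elems P"
  using U_inv unfolding elems_def by blast

lemma root_span_subgroup: "P \<subseteq> roots \<Longrightarrow> subgroup (root_span P) G"
  unfolding root_span_def by (intro generate_is_subgroup elems_carrier)

lemma root_span_carrier: "P \<subseteq> roots \<Longrightarrow> x \<in> root_span P \<Longrightarrow> x \<in> carrier G"
  by (rule subgroup.mem_carrier[OF root_span_subgroup])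

lemma root_span_mono: "P \<subseteq> Q \<Longrightarrow> root_span P \<subseteq> root_span Q"
  unfolding root_span_def elems_def by (intro mono_generate) auto

lemma root_elem_span: "(i, j) \<in> P \<Longrightarrow> x \<in> U i j \<Longrightarrow> x \<in> root_span P"
  unfolding root_span_def elems_def by (intro generate.incl) auto

lemma commute_U:
  assumes "(i, j) \<in> roots" "(l, k) \<in> roots" "j \<noteq> l" "i \<noteq> k" "a \<in> U i j" "b \<in> U l k"
  shows "a \<otimes> b = b \<otimes> a"
  using assms by (intro commute[of i j l k]) (auto simp: roots_def)

lemma conj_by_commute:
  assumes "(i, j) \<in> roots" "(l, k) \<in> roots" "j \<noteq> l" "i \<noteq> k" "a \<in> U i j" "b \<in> U l k"
  shows "conj_by a b = b"
  using commute_U[OF assms] U_carrier[OF assms(1,5)] U_carrier[OF assms(2,6)]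
  by (simp add: conj_by_eq_iff_commute)

text \<open>For \<open>a\<close> in \<open>U i j\<close> and \<open>b\<close> in
  \<open>U l p\<close> only \<open>j = l\<close> is not a commuting case. There
  \<open>conj_by a b\<close> is \<open>b\<close> times the inverse of the commutator of
  \<open>a\<close> and \<open>b\<close>, which lies in \<open>U i p\<close>, again in column
  \<open>p\<close>.\<close>

lemma conj_by_col_span:
  assumes "g \<in> root_span (levi_roots p)" "x \<in> root_span (col_roots p)"
  shows "conj_by g x \<in> root_span (col_roots p)"
  unfolding root_span_def
proof (rule conj_by_generate[of "elems (levi_roots p)"])
  fix a b assume "a \<in> elems (levi_roots p)" "b \<in> elems (col_roots p)"
  then obtain i j l where ij: "(i, j) \<in> levi_roots p" "a \<in> U i j" and lp: "(l, p) \<in> col_roots p" "b \<in> U l p"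
    by (auto simp: elems_def col_roots_def)
  then have r: "(i, j) \<in> roots" "(l, p) \<in> roots" "i \<noteq> p" "j \<noteq> p"
    by (auto simp: levi_roots_def col_roots_def)
  show "conj_by a b \<in> generate G (elems (col_roots p))"
  proof (cases "j = l")
    case True
    define c where "c = inv a \<otimes> inv b \<otimes> a \<otimes> b"
    have ip: "(i, p) \<in> col_roots p"
      using r by (auto simp: col_roots_def roots_def)
    have "c \<in> U i p"
      unfolding c_def using r ij lp True by (intro comm_mem[of i j p]) (auto simp: roots_def)
    then have "inv c \<in> root_span (col_roots p)"
      using ip root_sets(2) by (intro root_elem_span[OF ip] U_inv) auto
    with root_elem_span[OF lp] have "b \<otimes> inv c \<in> root_span (col_roots p)"
      by (rule subgroup.m_closed[OF root_span_subgroup[OF root_sets(2)]])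
    moreover have "a \<in> carrier G" "b \<in> carrier G"
      using U_carrier[OF r(1) ij(2)] U_carrier[OF r(2) lp(2)] by auto
    then have "b \<otimes> inv c = conj_by a b"
      by (simp add: c_def conj_by_def inv_mult_group m_assoc)
    ultimately show ?thesis
      by (simp add: root_span_def)
  next
    case False
    then have "conj_by a b = b"
      using r ij lp by (intro conj_by_commute[of i j l p]) auto
    then show ?thesis
      using root_elem_span[OF lp] by (simp add: root_span_def)
  qed
qed (use assms in \<open>simp_all add: root_span_def elems_carrier elems_inv root_sets\<close>)

lemma conj_by_row_span:
  assumes "g \<in> root_span (levi_roots p)" "x \<in> root_span (row_roots p)"
  shows "conj_by g x \<in> root_span (row_roots p)"
  unfolding root_span_def
proof (rule conj_by_generate[of "elems (levi_roots p)"])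
  fix a b assume "a \<in> elems (levi_roots p)" "b \<in> elems (row_roots p)"
  then obtain i j l where ij: "(i, j) \<in> levi_roots p" "a \<in> U i j" and pl: "(p, l) \<in> row_roots p" "b \<in> U p l"
    by (auto simp: elems_def row_roots_def)
  then have r: "(i, j) \<in> roots" "(p, l) \<in> roots" "i \<noteq> p" "j \<noteq> p"
    by (auto simp: levi_roots_def row_roots_def)
  show "conj_by a b \<in> generate G (elems (row_roots p))"
  proof (cases "i = l")
    case True
    \<comment> \<open>The indices now run from \<open>p\<close> through \<open>i\<close> to
      \<open>j\<close>, so \<open>b\<close> comes first in the commutator and no inverse of
      \<open>c\<close> occurs.\<close>
    define c where "c = inv b \<otimes> inv a \<otimes> b \<otimes> a"
    have pj: "(p, j) \<in> row_roots p"
      using r by (auto simp: row_roots_def roots_def)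
    have "c \<in> U p j"
      unfolding c_def using r ij pl True by (intro comm_mem[of p i j]) (auto simp: roots_def)
    from root_elem_span[OF pl] root_elem_span[OF pj this] have "b \<otimes> c \<in> root_span (row_roots p)"
      by (rule subgroup.m_closed[OF root_span_subgroup[OF root_sets(3)]])
    moreover have "a \<in> carrier G" "b \<in> carrier G"
      using U_carrier[OF r(1) ij(2)] U_carrier[OF r(2) pl(2)] by auto
    then have "b \<otimes> c = conj_by a b"
      by (simp add: c_def conj_by_def m_assoc)
    ultimately show ?thesis
      by (simp add: root_span_def)
  next
    case False
    then have "conj_by a b = b"
      using r ij pl by (intro conj_by_commute[of i j p l]) auto
    then show ?thesis
      using root_elem_span[OF pl] by (simp add: root_span_def)
  qed
qed (use assms in \<open>simp_all add: root_span_def elems_carrier elems_inv root_sets\<close>)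

text \<open>Each element of \<open>U i j\<close> is a commutator of elements of \<open>U i p\<close>
  and \<open>U p j\<close>, so a conjugation fixing column and row \<open>p\<close> fixes it
  too.\<close>

lemma conj_by_trivial_if_trivial_on_col_row:
  assumes g: "g \<in> carrier G" and p: "p \<in> {1..n}"
    and col_roots: "\<And>x. x \<in> elems (col_roots p) \<Longrightarrow> conj_by g x = x"
    and row_roots: "\<And>x. x \<in> elems (row_roots p) \<Longrightarrow> conj_by g x = x"
    and x: "x \<in> elems (levi_roots p)"
  shows "conj_by g x = x"
proof -
  obtain i j where ij: "(i, j) \<in> levi_roots p" "x \<in> U i j"
    using x by (auto simp: elems_def)
  then obtain a b where ab: "a \<in> U i p" "b \<in> U p j" "x = inv a \<otimes> inv b \<otimes> a \<otimes> b"
    using comm_ex[of i p j x] p by (auto simp: levi_roots_def roots_def)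
  have r: "(i, p) \<in> col_roots p" "(p, j) \<in> row_roots p"
    using ij p by (auto simp: levi_roots_def col_roots_def row_roots_def roots_def)
  then have "(i, p) \<in> roots" "(p, j) \<in> roots"
    by (simp_all add: col_roots_def row_roots_def)
  then have c: "a \<in> carrier G" "b \<in> carrier G"
    using ab U_carrier by auto
  have "conj_by g a = a" "conj_by g b = b"
    using col_roots row_roots ab r by (auto simp: elems_def)
  then show ?thesis
    using g c by (simp add: ab conj_by_mult conj_by_inv)
qed

end

section \<open>Finite root subgroups: radicals and Levi factors\<close>

locale finite_root_subgroups = root_subgroups +
  assumes finite_U: "(i, j) \<in> roots \<Longrightarrow> finite (U i j)"
begin

lemma finite_elems: "P \<subseteq> roots \<Longrightarrow> finite (elems P)"
  unfolding elems_def using finite_roots finite_U finite_subset by (intro finite_UN_I) auto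

lemma elems_torsion: "P \<subseteq> roots \<Longrightarrow> x \<in> elems P \<Longrightarrow> \<exists>m>0. x [^] (m::nat) = \<one>"
  unfolding elems_def using finite_subgroup_torsion[OF subgroup_U' finite_U] by blast

text \<open>Root subgroups in one column commute, so their union is stable under its own
  conjugations and Dietzmann's lemma applies.\<close>

lemma finite_span_col: "finite (root_span (col_roots p))"
  unfolding root_span_def
proof (rule generate_finite_torsion_conj_closed)
  fix s t assume st: "s \<in> elems (col_roots p)" "t \<in> elems (col_roots p)"
  then obtain i l where "(i, p) \<in> roots" "(l, p) \<in> roots" "s \<in> U i p" "t \<in> U l p"
    by (auto simp: elems_def col_roots_def)
  then have "conj_by s t = t"
    by (intro conj_by_commute[of i p l p]) (auto simp: roots_def)
  with st show "conj_by s t \<in> elems (col_roots p)"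
    by simp
qed (simp_all add: finite_elems elems_carrier root_sets elems_torsion[OF root_sets(2)])

lemma finite_span_row: "finite (root_span (row_roots p))"
  unfolding root_span_def
proof (rule generate_finite_torsion_conj_closed)
  fix s t assume st: "s \<in> elems (row_roots p)" "t \<in> elems (row_roots p)"
  then obtain j l where "(p, j) \<in> roots" "(p, l) \<in> roots" "s \<in> U p j" "t \<in> U p l"
    by (auto simp: elems_def row_roots_def)
  then have "conj_by s t = t"
    by (intro conj_by_commute[of p j p l]) (auto simp: roots_def)
  with st show "conj_by s t \<in> elems (row_roots p)"
    by simp
qed (simp_all add: finite_elems elems_carrier root_sets elems_torsion[OF root_sets(3)])

text \<open>
  The kernel of the conjugation action of \<open>root_span (levi_roots p)\<close> on the finite groups \<open>root_span (col_roots p)\<close> and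
  \<open>root_span (row_roots p)\<close> is central, because these two generate everything. So every generator has only
  finitely many conjugates and Dietzmann's lemma applies.
\<close>

lemma finite_span_levi:
  assumes p: "p \<in> {1..n}"
  shows "finite (root_span (levi_roots p))"
proof -
  let ?L = "root_span (levi_roots p)"
  define F where "F = root_span (col_roots p) \<union> root_span (row_roots p)"
  \<comment> \<open>Restriction to \<open>F\<close> makes equality of actions mean equality on
    \<open>F\<close>, and puts all actions into the finite set
    \<open>F \<rightarrow>\<^sub>E F\<close>.\<close>
  define act where "act g = (\<lambda>x\<in>F. conj_by g x)" for g
  have L: "g \<in> carrier G" if "g \<in> ?L" for g
    using root_span_carrier[OF root_sets(1) that] .
  have Lsub: "subgroup ?L G"
    by (rule root_span_subgroup[OF root_sets(1)])
  have E: "x \<in> carrier G" if "x \<in> elems (levi_roots p)" for x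
    using elems_carrier[OF root_sets(1)] that by blast
  have F: "x \<in> carrier G" if "x \<in> F" for x
    using that root_span_carrier[OF root_sets(2)] root_span_carrier[OF root_sets(3)] unfolding F_def by blast
  have "act ` ?L \<subseteq> F \<rightarrow>\<^sub>E F"
  proof (rule image_subsetI)
    fix g assume g: "g \<in> ?L"
    have "conj_by g x \<in> F" if "x \<in> F" for x
      using that conj_by_col_span[OF g] conj_by_row_span[OF g] unfolding F_def by auto
    then show "act g \<in> F \<rightarrow>\<^sub>E F"
      by (intro PiE_I) (simp_all add: act_def)
  qed
  moreover have "finite (F \<rightarrow>\<^sub>E F)"
    by (intro finite_PiE) (auto simp: F_def finite_span_col finite_span_row)
  ultimately have fin_act: "finite (act ` ?L)"
    by (rule finite_subset)
  \<comment> \<open>If \<open>g\<close> and \<open>h\<close> act alike on \<open>F\<close>, then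
    \<open>g \<otimes> inv h\<close> fixes column and row \<open>p\<close>, hence \<open>s\<close>.
    So a conjugate of \<open>s\<close> depends only on the action of the conjugating
    element.\<close>
  have factor: "conj_by g s = conj_by h s"
    if g: "g \<in> ?L" and h: "h \<in> ?L" and eq: "act g = act h" and s: "s \<in> elems (levi_roots p)" for g h s
  proof -
    let ?k = "g \<otimes> inv h"
    note [simp] = L[OF g] L[OF h]
    have k: "conj_by ?k x = x" if x: "x \<in> F" for x
    proof -
      have "conj_by g x = conj_by h x"
        using fun_cong[OF eq, of x] x by (simp add: act_def)
      then have "conj_by (inv h) (conj_by g x) = conj_by (inv h) (conj_by h x)"
        by simp
      then show ?thesis
        using F[OF x] by (simp add: conj_by_conj_by)
    qed
    have "conj_by ?k s = s"
    proof (rule conj_by_trivial_if_trivial_on_col_row[OF _ p _ _ s])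
      show "conj_by ?k x = x" if "x \<in> elems (col_roots p)" for x
        using that by (intro k) (auto simp: F_def root_span_def intro: generate.incl)
      show "conj_by ?k x = x" if "x \<in> elems (row_roots p)" for x
        using that by (intro k) (auto simp: F_def root_span_def intro: generate.incl)
    qed simp
    then have "conj_by h (conj_by ?k s) = conj_by h s"
      by simp
    then show ?thesis
      using E[OF s] by (simp add: conj_by_conj_by m_assoc)
  qed
  \<comment> \<open>Dietzmann's lemma asks for a set closed under conjugation, hence all conjugates
    of the root elements under the Levi group.\<close>
  define T where "T = (\<Union>g\<in>?L. conj_by g ` elems (levi_roots p))"
  have TL: "T \<subseteq> ?L"
  proof
    fix t assume "t \<in> T"
    then obtain g s where g: "g \<in> ?L" "s \<in> elems (levi_roots p)" "t = conj_by g s"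
      unfolding T_def by blast
    moreover from g have "s \<in> ?L"
      by (simp add: root_span_def generate.incl)
    ultimately show "t \<in> ?L"
      unfolding conj_by_def
      by (simp add: subgroup.m_closed[OF Lsub] subgroup.m_inv_closed[OF Lsub])
  qed
  have "finite T"
  proof -
    \<comment> \<open>One representative for each of the finitely many actions already yields every
      conjugate.\<close>
    define r where "r = inv_into ?L act"
    have r: "r a \<in> ?L" "act (r a) = a" if "a \<in> act ` ?L" for a
      using that unfolding r_def by (simp_all add: inv_into_into f_inv_into_f)
    have "T \<subseteq> (\<Union>a\<in>act ` ?L. conj_by (r a) ` elems (levi_roots p))"
    proof
      fix t assume "t \<in> T"
      then obtain g s where g: "g \<in> ?L" "s \<in> elems (levi_roots p)" "t = conj_by g s"
        unfolding T_def by blast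
      moreover from g(1) have "act g \<in> act ` ?L"
        by (rule imageI)
      ultimately have "t = conj_by (r (act g)) s"
        using factor[OF g(1) r(1)[of "act g"] _ g(2)] r(2)[of "act g"] by simp
      then show "t \<in> (\<Union>a\<in>act ` ?L. conj_by (r a) ` elems (levi_roots p))"
        using g by blast
    qed
    then show ?thesis
      by (rule finite_subset) (intro finite_UN_I fin_act finite_imageI finite_elems root_sets)
  qed
  have "finite (generate G T)"
  proof (rule generate_finite_torsion_conj_closed)
    show "T \<subseteq> carrier G"
      using TL L by blast
    show "finite T" by fact
  next
    fix s t assume s: "s \<in> T" and "t \<in> T"
    then obtain g x where g: "g \<in> ?L" "x \<in> elems (levi_roots p)" "t = conj_by g x"
      unfolding T_def by blast
    have sL: "s \<in> ?L"
      using s TL by blast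
    have "x \<in> carrier G"
      by (rule E[OF g(2)])
    then have *: "conj_by s t = conj_by (g \<otimes> s) x"
      unfolding g(3) by (rule conj_by_conj_by[OF L[OF g(1)] L[OF sL]])
    have "g \<otimes> s \<in> ?L"
      by (rule subgroup.m_closed[OF Lsub g(1) sL])
    then show "conj_by s t \<in> T"
      unfolding T_def * by (rule UN_I) (rule imageI, rule g(2))
  next
    fix t assume "t \<in> T"
    then obtain g x where g: "g \<in> ?L" "x \<in> elems (levi_roots p)" "t = conj_by g x"
      unfolding T_def by blast
    have x: "x \<in> carrier G"
      by (rule E[OF g(2)])
    obtain m :: nat where m: "m > 0" "x [^] m = \<one>"
      using elems_torsion[OF root_sets(1) g(2)] by blast
    have "t [^] m = \<one>"
      unfolding g(3) by (simp add: m(2) L[OF g(1)] x conj_by_pow[OF L[OF g(1)] x, symmetric])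
    then show "\<exists>m>0. t [^] (m::nat) = \<one>"
      using m(1) by blast
  qed
  moreover have "?L \<subseteq> generate G T"
  proof -
    have "elems (levi_roots p) \<subseteq> T"
    proof
      fix x assume x: "x \<in> elems (levi_roots p)"
      then have "x = conj_by \<one> x"
        by (simp add: E)
      moreover have "\<one> \<in> ?L"
        by (simp add: root_span_def generate.one)
      ultimately show "x \<in> T"
        unfolding T_def by (metis UN_I image_eqI x)
    qed
    then show ?thesis
      unfolding root_span_def by (rule mono_generate)
  qed
  ultimately show ?thesis
    by (rule rev_finite_subset)
qed

end

section \<open>Bounded generation\<close>

context group
begin

text \<open>The \<open>m\<close>-th power of the product set of \<open>A\<close> and
  \<open>B\<close>. Unlike the group they generate, it is finite as soon as \<open>A\<close> and
  \<open>B\<close> are.\<close>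

primrec alt_prod :: "'a set \<Rightarrow> 'a set \<Rightarrow> nat \<Rightarrow> 'a set"
  where
    "alt_prod A B 0 = {\<one>}"
  | "alt_prod A B (Suc m) = {x \<otimes> a \<otimes> b | x a b. x \<in> alt_prod A B m \<and> a \<in> A \<and> b \<in> B}"

lemma finite_alt_prod:
  assumes "finite A" "finite B"
  shows "finite (alt_prod A B m)"
proof (induction m)
  case (Suc m)
  have "alt_prod A B (Suc m) = (\<lambda>(x, a, b). x \<otimes> a \<otimes> b) ` (alt_prod A B m \<times> A \<times> B)"
    by force
  then show ?case
    using Suc assms by simp
qed simp

lemma alt_prod_subset:
  assumes "subgroup K G" "A \<subseteq> K" "B \<subseteq> K"
  shows "alt_prod A B m \<subseteq> K"
proof (induction m)
  case 0
  then show ?case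
    using subgroup.one_closed[OF assms(1)] by simp
next
  case (Suc m)
  then show ?case
    using assms(2,3) subgroup.m_closed[OF assms(1)] by (simp add: subset_iff) blast
qed

lemma alt_prod_carrier: "A \<subseteq> carrier G \<Longrightarrow> B \<subseteq> carrier G \<Longrightarrow> alt_prod A B m \<subseteq> carrier G"
  by (rule alt_prod_subset[OF subgroup_self])

lemma alt_prod_Suc_subset:
  assumes A: "subgroup A G" and B: "subgroup B G"
  shows "alt_prod A B m \<subseteq> alt_prod A B (Suc m)"
proof
  fix x assume x: "x \<in> alt_prod A B m"
  then have "x \<in> carrier G"
    using alt_prod_carrier[OF subgroup.subset[OF A] subgroup.subset[OF B]] by blast
  then have "x = x \<otimes> \<one> \<otimes> \<one>"
    by simp
  then show "x \<in> alt_prod A B (Suc m)"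
    using x subgroup.one_closed[OF A] subgroup.one_closed[OF B] unfolding alt_prod.simps by blast
qed

lemma alt_prod_mono:
  assumes "subgroup A G" "subgroup B G" "m \<le> k"
  shows "alt_prod A B m \<subseteq> alt_prod A B k"
  using assms(3) lift_Suc_mono_le[of "alt_prod A B", OF alt_prod_Suc_subset[OF assms(1,2)]] by blast

lemma alt_prod_add:
  assumes A: "A \<subseteq> carrier G" and B: "B \<subseteq> carrier G"
    and x: "x \<in> alt_prod A B m" and y: "y \<in> alt_prod A B k"
  shows "x \<otimes> y \<in> alt_prod A B (m + k)"
  using y
proof (induction k arbitrary: y)
  case 0
  then show ?case
    using x alt_prod_carrier[OF A B, of m] by auto
next
  case (Suc k)
  then obtain z a b where y: "y = z \<otimes> a \<otimes> b" "z \<in> alt_prod A B k" "a \<in> A" "b \<in> B"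
    by auto
  have "x \<in> carrier G" "z \<in> carrier G" "a \<in> carrier G" "b \<in> carrier G"
    using x y A B alt_prod_carrier[OF A B] by blast+
  then have "x \<otimes> y = (x \<otimes> z) \<otimes> a \<otimes> b"
    by (simp add: y m_assoc)
  then show ?case
    using Suc.IH[OF y(2)] y(3,4) by auto
qed

lemma generate_subset_alt_prod:
  assumes A: "subgroup A G" and B: "subgroup B G" and g: "g \<in> generate G (A \<union> B)"
  shows "\<exists>m. g \<in> alt_prod A B m"
proof -
  note sub = subgroup.subset[OF A] subgroup.subset[OF B]
  have one: "x \<in> alt_prod A B (Suc 0)" if x: "x \<in> A \<union> B" for x
  proof -
    have "x = \<one> \<otimes> x \<otimes> \<one>" "x = \<one> \<otimes> \<one> \<otimes> x"
      using x sub by auto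
    then show ?thesis
      using x subgroup.one_closed[OF A] subgroup.one_closed[OF B] unfolding alt_prod.simps by blast
  qed
  show ?thesis
    using g
  proof (induction rule: generate.induct)
    case one
    show ?case
      by (rule exI[of _ 0]) simp
  next
    case (incl h)
    then show ?case
      using one by blast
  next
    case (inv h)
    then have "inv h \<in> A \<union> B"
      using subgroup.m_inv_closed[OF A] subgroup.m_inv_closed[OF B] by auto
    then show ?case
      using one by blast
  next
    case (eng g h)
    then show ?case
      using alt_prod_add[OF sub] by blast
  qed
qed

text \<open>The powers form an increasing chain exhausting the generated group, so a finite group is
  reached at some stage. The claim covers all later stages so that the thresholds of two Levi
  factors can be met at once.\<close>

lemma finite_generate_subset_alt_prod:
  assumes A: "subgroup A G" and B: "subgroup B G" and fin: "finite (generate G (A \<union> B))"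
  shows "\<exists>m. \<forall>k\<ge>m. generate G (A \<union> B) \<subseteq> alt_prod A B k"
proof -
  obtain f where f: "g \<in> alt_prod A B (f g)" if "g \<in> generate G (A \<union> B)" for g
    using generate_subset_alt_prod[OF A B] by metis
  have "g \<in> alt_prod A B k"
    if g: "g \<in> generate G (A \<union> B)" and k: "Max (f ` generate G (A \<union> B)) \<le> k" for g k
  proof -
    have "f g \<le> k"
      using Max_ge[OF finite_imageI[OF fin, of f] imageI[OF g, of f]] k by linarith
    then show ?thesis
      using f[OF g] alt_prod_mono[OF A B] by blast
  qed
  then show ?thesis
    by blast
qed

text \<open>As \<open>L\<close> normalises \<open>N\<close>, products \<open>u \<otimes> l\<close>
  are closed under multiplication: moving \<open>v\<close> left past \<open>l\<close> turns it into
  \<open>conj_by (inv l) v\<close>.\<close>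

lemma generate_subset_normalized_prod:
  assumes N: "subgroup N G" and L: "subgroup L G"
    and conj: "\<And>l u. l \<in> L \<Longrightarrow> u \<in> N \<Longrightarrow> conj_by l u \<in> N"
    and S: "S \<subseteq> N \<union> L" and g: "g \<in> generate G S"
  shows "\<exists>u\<in>N. \<exists>l\<in>L. g = u \<otimes> l"
proof -
  note ones = subgroup.one_closed[OF N] subgroup.one_closed[OF L]
  note carr = subgroup.mem_carrier[OF N] subgroup.mem_carrier[OF L]
  have *: "\<exists>u\<in>N. \<exists>l\<in>L. x = u \<otimes> l" if x: "x \<in> N \<union> L" for x
  proof -
    have "x = x \<otimes> \<one>" "x = \<one> \<otimes> x"
      using x carr by auto
    then show ?thesis
      using x ones by blast
  qed
  show ?thesis
    using g
  proof (induction rule: generate.induct)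
    case one
    then show ?case
      using * ones by blast
  next
    case (incl h)
    then show ?case
      using S by (intro *) auto
  next
    case (inv h)
    then have "inv h \<in> N \<union> L"
      using S subgroup.m_inv_closed[OF N] subgroup.m_inv_closed[OF L] by auto
    then show ?case
      by (rule *)
  next
    case (eng g h)
    then obtain u l v k where *: "u \<in> N" "l \<in> L" "g = u \<otimes> l" "v \<in> N" "k \<in> L" "h = v \<otimes> k"
      by auto
    note c = carr(1)[OF *(1)] carr(1)[OF *(4)] carr(2)[OF *(2)] carr(2)[OF *(5)]
    have "g \<otimes> h = (u \<otimes> conj_by (inv l) v) \<otimes> (l \<otimes> k)"
      using c by (simp add: * conj_by_def m_assoc)
    moreover have "conj_by (inv l) v \<in> N"
      using * by (intro conj subgroup.m_inv_closed[OF L])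
    ultimately show ?case
      using * subgroup.m_closed[OF N] subgroup.m_closed[OF L] by blast
  qed
qed

text \<open>
  Tavgen's reduction: both inclusions between \<open>(A B)\<^sup>m\<close> and \<open>(N M)\<^sup>m L\<close> hold, and the latter set is
  visibly stable under right multiplication by \<open>L\<close>.
\<close>

lemma alt_prod_mult_closed:
  assumes A: "subgroup A G" and B: "subgroup B G" and L: "subgroup L G"
    and N: "subgroup N G" and M: "subgroup M G"
    and conjN: "\<And>l u. l \<in> L \<Longrightarrow> u \<in> N \<Longrightarrow> conj_by l u \<in> N"
    and conjM: "\<And>l u. l \<in> L \<Longrightarrow> u \<in> M \<Longrightarrow> conj_by l u \<in> M"
    and decA: "\<And>a. a \<in> A \<Longrightarrow> \<exists>u\<in>N. \<exists>l\<in>L. a = u \<otimes> l"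
    and decB: "\<And>b. b \<in> B \<Longrightarrow> \<exists>u\<in>M. \<exists>l\<in>L. b = u \<otimes> l"
    and NA: "N \<subseteq> A" and MB: "M \<subseteq> B"
    and A': "A' \<subseteq> A" "A' \<subseteq> L" and B': "B' \<subseteq> B" "B' \<subseteq> L"
    and bound: "L \<subseteq> alt_prod A' B' m"
    and x: "x \<in> alt_prod A B m" and l: "l \<in> L"
  shows "x \<otimes> l \<in> alt_prod A B m"
proof -
  note cN = subgroup.mem_carrier[OF N] and cM = subgroup.mem_carrier[OF M]
    and cL = subgroup.mem_carrier[OF L]
  have cP: "y \<in> carrier G" if "y \<in> alt_prod N M k" for y k
    using that alt_prod_carrier[OF subgroup.subset[OF N] subgroup.subset[OF M]] by blast
  \<comment> \<open>Decompose every factor by \<open>decA\<close> and \<open>decB\<close> and push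
    the parts in \<open>L\<close> to the far right; the parts in \<open>N\<close> and
    \<open>M\<close> are merely conjugated.\<close>
  have split: "\<exists>y\<in>alt_prod N M k. \<exists>l\<in>L. x = y \<otimes> l" if "x \<in> alt_prod A B k" for k x
    using that
  proof (induction k arbitrary: x)
    case 0
    then show ?case
      using subgroup.one_closed[OF L] by (auto intro!: bexI[of _ \<one>])
  next
    case (Suc k)
    then obtain x' a b where x: "x = x' \<otimes> a \<otimes> b" "x' \<in> alt_prod A B k" "a \<in> A" "b \<in> B"
      by auto
    obtain y l where y: "y \<in> alt_prod N M k" "l \<in> L" "x' = y \<otimes> l"
      using Suc.IH x(2) by blast
    obtain u l1 where a: "u \<in> N" "l1 \<in> L" "a = u \<otimes> l1"
      using decA x(3) by blast
    obtain v l2 where b: "v \<in> M" "l2 \<in> L" "b = v \<otimes> l2"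
      using decB x(4) by blast
    have L3: "l \<otimes> l1 \<in> L" "l \<otimes> l1 \<otimes> l2 \<in> L"
      using y a b by (simp_all add: subgroup.m_closed[OF L])
    have mem: "conj_by (inv l) u \<in> N" "conj_by (inv (l \<otimes> l1)) v \<in> M"
      using y a b L3 by (simp_all add: conjN conjM subgroup.m_inv_closed[OF L])
    have "x = (y \<otimes> conj_by (inv l) u \<otimes> conj_by (inv (l \<otimes> l1)) v) \<otimes> (l \<otimes> l1 \<otimes> l2)"
      using cP[OF y(1)] cL[OF y(2)] cL[OF a(2)] cL[OF b(2)] cN[OF a(1)] cM[OF b(1)]
      by (simp add: x y a b conj_by_def m_assoc inv_mult_group)
    moreover have "y \<otimes> conj_by (inv l) u \<otimes> conj_by (inv (l \<otimes> l1)) v \<in> alt_prod N M (Suc k)"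
      using y(1) mem by auto
    ultimately show ?case
      using L3 by blast
  qed
  \<comment> \<open>The converse: the factors of \<open>z\<close> are slotted into those of
    \<open>y\<close>. Moving \<open>z'\<close> past \<open>u\<close> and \<open>v\<close>, and
    \<open>a\<close> past \<open>v\<close>, conjugates within \<open>N\<close> and \<open>M\<close>;
    then a factor in \<open>N\<close> joins one in \<open>A'\<close> inside \<open>A\<close>, and
    likewise inside \<open>B\<close>.\<close>
  have merge: "y \<otimes> z \<in> alt_prod A B k"
    if "y \<in> alt_prod N M k" "z \<in> alt_prod A' B' k" for k y z
    using that
  proof (induction k arbitrary: y z)
    case 0
    then show ?case
      by simp
  next
    case (Suc k)
    then obtain y' u v z' a b where
      y: "y = y' \<otimes> u \<otimes> v" "y' \<in> alt_prod N M k" "u \<in> N" "v \<in> M" and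
      z: "z = z' \<otimes> a \<otimes> b" "z' \<in> alt_prod A' B' k" "a \<in> A'" "b \<in> B'"
      by auto
    have zL: "z' \<in> L"
      using z(2) alt_prod_subset[OF L A'(2) B'(2)] by blast
    have ab: "a \<in> L" "b \<in> L" "a \<in> A" "b \<in> B"
      using z A' B' by auto
    have mem: "conj_by z' u \<otimes> a \<in> A" "conj_by a (conj_by z' v) \<otimes> b \<in> B"
      using zL y ab NA MB
      by (auto intro!: subgroup.m_closed[OF A] subgroup.m_closed[OF B] dest: conjN conjM)
    have "y \<otimes> z = (y' \<otimes> z') \<otimes> (conj_by z' u \<otimes> a) \<otimes> (conj_by a (conj_by z' v) \<otimes> b)"
      using cP[OF y(2)] cL[OF zL] cL[OF ab(1)] cL[OF ab(2)] cN[OF y(3)] cM[OF y(4)]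
      by (simp add: y z conj_by_def m_assoc)
    then show ?case
      using Suc.IH[OF y(2) z(2)] mem by auto
  qed
  obtain y l' where y: "y \<in> alt_prod N M m" "l' \<in> L" "x = y \<otimes> l'"
    using split[OF x] by blast
  \<comment> \<open>The whole part in \<open>L\<close> is rewritten by \<open>bound\<close> as an
    alternating word of the same length \<open>m\<close>, ready for merging.\<close>
  then have "l' \<otimes> l \<in> alt_prod A' B' m"
    using l bound subgroup.m_closed[OF L] by blast
  moreover have "x \<otimes> l = y \<otimes> (l' \<otimes> l)"
    using y l cP cL by (simp add: m_assoc)
  ultimately show ?thesis
    using merge y(1) by simp
qed

end

section \<open>Finiteness of the group generated by finite root subgroups\<close>

context finite_root_subgroups
begin

definition upper_roots :: "(nat \<times> nat) set"
  where "upper_roots = {(i, j) \<in> roots. i < j}"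

definition lower_roots :: "(nat \<times> nat) set"
  where "lower_roots = {(i, j) \<in> roots. j < i}"

lemma triangular_roots: "upper_roots \<subseteq> roots" "lower_roots \<subseteq> roots"
  by (auto simp: upper_roots_def lower_roots_def)

abbreviation ul_prod :: "nat \<Rightarrow> 'a set"
  where "ul_prod \<equiv> alt_prod (root_span upper_roots) (root_span lower_roots)"

lemma elems_Un: "elems (P \<union> Q) = elems P \<union> elems Q"
  by (auto simp: elems_def)

lemma root_span_Un:
  assumes "P \<subseteq> roots" "Q \<subseteq> roots"
  shows "generate G (root_span P \<union> root_span Q) = root_span (P \<union> Q)"
proof
  show "generate G (root_span P \<union> root_span Q) \<subseteq> root_span (P \<union> Q)"
    using assms root_span_mono[of P "P \<union> Q"] root_span_mono[of Q "P \<union> Q"]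
    by (intro generate_subgroup_incl root_span_subgroup) auto
  show "root_span (P \<union> Q) \<subseteq> generate G (root_span P \<union> root_span Q)"
    unfolding root_span_def elems_Un by (intro mono_generate) (auto intro: generate.incl)
qed

text \<open>The Levi decomposition inside a parabolic: the Levi factor normalises the radical
  spanned by \<open>P\<close>.\<close>

lemma root_span_decompose:
  assumes PQ: "P = col_roots p \<or> P = row_roots p" and T: "T \<subseteq> P \<union> levi_roots p"
    and g: "g \<in> root_span T"
  shows "\<exists>u\<in>root_span P. \<exists>l\<in>root_span (levi_roots p). g = u \<otimes> l"
proof (rule generate_subset_normalized_prod)
  show "subgroup (root_span P) G"
    using PQ root_span_subgroup[OF root_sets(2)] root_span_subgroup[OF root_sets(3)] by auto
  show "subgroup (root_span (levi_roots p)) G"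
    by (rule root_span_subgroup[OF root_sets(1)])
  show "conj_by l u \<in> root_span P" if "l \<in> root_span (levi_roots p)" "u \<in> root_span P" for l u
    using PQ that conj_by_col_span[of l p u] conj_by_row_span[of l p u] by auto
  show "elems T \<subseteq> root_span P \<union> root_span (levi_roots p)"
    using T root_elem_span unfolding elems_def by blast
  show "g \<in> generate G (elems T)"
    using g by (simp add: root_span_def)
qed

text \<open>Tavgen's reduction with radicals \<open>P\<close> and \<open>Q\<close>. The Levi factor
  is finite and generated by its upper and lower parts, hence a bounded alternating product of them;
  this is the source of the threshold.\<close>

lemma ul_prod_mult_closed:
  assumes p: "p \<in> {1..n}"
    and PQ: "P = col_roots p \<and> Q = row_roots p \<or> P = row_roots p \<and> Q = col_roots p"
    and P: "P \<subseteq> upper_roots" and Q: "Q \<subseteq> lower_roots"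
  shows "\<exists>m. \<forall>k\<ge>m. \<forall>x\<in>ul_prod k. \<forall>l\<in>root_span (levi_roots p). x \<otimes> l \<in> ul_prod k"
proof -
  let ?A = "root_span upper_roots" and ?B = "root_span lower_roots"
    and ?A' = "root_span (upper_roots \<inter> levi_roots p)"
    and ?B' = "root_span (lower_roots \<inter> levi_roots p)"
    and ?L = "root_span (levi_roots p)"
  have sub: "upper_roots \<inter> levi_roots p \<subseteq> roots" "lower_roots \<inter> levi_roots p \<subseteq> roots"
    using triangular_roots by auto
  note sg = root_span_subgroup[OF triangular_roots(1)] root_span_subgroup[OF triangular_roots(2)]
    root_span_subgroup[OF root_sets(1)]
  have PQr: "P \<subseteq> roots" "Q \<subseteq> roots"
    using P Q triangular_roots by auto
  have "(upper_roots \<inter> levi_roots p) \<union> (lower_roots \<inter> levi_roots p) = levi_roots p"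
    by (auto simp: upper_roots_def lower_roots_def levi_roots_def roots_def)
  then have L: "generate G (?A' \<union> ?B') = ?L"
    using root_span_Un[OF sub] by simp
  obtain m where m: "\<forall>k\<ge>m. ?L \<subseteq> alt_prod ?A' ?B' k"
    using finite_generate_subset_alt_prod[OF root_span_subgroup[OF sub(1)]
        root_span_subgroup[OF sub(2)]] finite_span_levi[OF p] unfolding L by blast
  have all: "roots \<subseteq> P \<union> Q \<union> levi_roots p"
    using PQ by (auto simp: levi_roots_def col_roots_def row_roots_def)
  have disj: "upper_roots \<inter> lower_roots = {}"
    by (auto simp: upper_roots_def lower_roots_def)
  \<comment> \<open>Every root is in \<open>P\<close>, \<open>Q\<close> or the Levi set, and an
    upper root cannot be in \<open>Q\<close>, nor a lower one in \<open>P\<close>. So each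
    triangular group lies in a parabolic.\<close>
  have dec: "upper_roots \<subseteq> P \<union> levi_roots p" "lower_roots \<subseteq> Q \<union> levi_roots p"
    using all disj triangular_roots P Q by blast+
  have PQ': "P = col_roots p \<or> P = row_roots p" "Q = col_roots p \<or> Q = row_roots p"
    using PQ by auto
  have conj: "conj_by l u \<in> root_span P"
    if "P = col_roots p \<or> P = row_roots p" "l \<in> ?L" "u \<in> root_span P" for l u P
    using that conj_by_col_span[of l p u] conj_by_row_span[of l p u] by auto
  have "x \<otimes> l \<in> ul_prod k" if k: "k \<ge> m" and x: "x \<in> ul_prod k" and l: "l \<in> ?L" for k x l
  proof (rule alt_prod_mult_closed[OF sg root_span_subgroup[OF PQr(1)] root_span_subgroup[OF PQr(2)]
        conj[OF PQ'(1)] conj[OF PQ'(2)] _ _ _ _ _ _ _ _ _ x l, where A' = ?A' and B' = ?B'])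
    show "\<exists>u\<in>root_span P. \<exists>l\<in>?L. a = u \<otimes> l" if "a \<in> ?A" for a
      by (rule root_span_decompose[OF PQ'(1) dec(1) that])
    show "\<exists>u\<in>root_span Q. \<exists>l\<in>?L. b = u \<otimes> l" if "b \<in> ?B" for b
      by (rule root_span_decompose[OF PQ'(2) dec(2) that])
    show "?L \<subseteq> alt_prod ?A' ?B' k"
      using m k by blast
  qed (use P Q in \<open>simp_all add: root_span_mono\<close>)
  then show ?thesis
    by blast
qed

text \<open>The span lies in the product of two finite groups, the radical and the Levi
  factor.\<close>

lemma finite_root_span_triangular:
  assumes p: "p \<in> {1..n}" and P: "P = col_roots p \<or> P = row_roots p"
    and T: "T \<subseteq> P \<union> levi_roots p"
  shows "finite (root_span T)"
proof -
  have "root_span T \<subseteq> (\<lambda>(u, l). u \<otimes> l) ` (root_span P \<times> root_span (levi_roots p))"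
    using root_span_decompose[OF P T] by force
  moreover have "finite (root_span P)"
    using P finite_span_col finite_span_row by auto
  ultimately show ?thesis
    using finite_span_levi[OF p] by (auto intro: finite_subset)
qed

text \<open>A finite set containing the identity and stable under right multiplication by generators
  contains the whole group. The Levi factors for \<open>1\<close> and \<open>n\<close> together
  generate, since \<open>n \<ge> 3\<close>.\<close>

theorem finite_root_span: "finite (root_span roots)"
proof -
  have n: "1 \<in> {1..n}" "n \<in> {1..n}" "2 \<in> {1..n}"
    using n_ge_3 by auto
  \<comment> \<open>Row \<open>1\<close> and column \<open>n\<close> lie above the diagonal, so the
    upper radical is the row for index \<open>1\<close> and the column for index
    \<open>n\<close>.\<close>
  have "\<exists>m. \<forall>k\<ge>m. \<forall>x\<in>ul_prod k. \<forall>l\<in>root_span (levi_roots 1). x \<otimes> l \<in> ul_prod k"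
    by (rule ul_prod_mult_closed[of 1 "row_roots 1" "col_roots 1"])
      (use n_ge_3 in \<open>auto simp: row_roots_def col_roots_def upper_roots_def lower_roots_def roots_def\<close>)
  then obtain m1 where
    m1: "\<And>k x l. k \<ge> m1 \<Longrightarrow> x \<in> ul_prod k \<Longrightarrow> l \<in> root_span (levi_roots 1) \<Longrightarrow> x \<otimes> l \<in> ul_prod k"
    by blast
  have "\<exists>m. \<forall>k\<ge>m. \<forall>x\<in>ul_prod k. \<forall>l\<in>root_span (levi_roots n). x \<otimes> l \<in> ul_prod k"
    by (rule ul_prod_mult_closed[of n "col_roots n" "row_roots n"])
      (use n_ge_3 in \<open>auto simp: row_roots_def col_roots_def upper_roots_def lower_roots_def roots_def\<close>)
  then obtain m2 where
    m2: "\<And>k x l. k \<ge> m2 \<Longrightarrow> x \<in> ul_prod k \<Longrightarrow> l \<in> root_span (levi_roots n) \<Longrightarrow> x \<otimes> l \<in> ul_prod k"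
    by blast
  define V where "V = ul_prod (max m1 m2)"
  have VG: "V \<subseteq> carrier G"
    unfolding V_def using root_span_carrier[OF triangular_roots(1)]
      root_span_carrier[OF triangular_roots(2)] by (intro alt_prod_carrier) auto
  have step: "x \<otimes> l \<in> V"
    if "x \<in> V" "l \<in> root_span (levi_roots 1) \<or> l \<in> root_span (levi_roots n)" for x l
    using that m1[of "max m1 m2"] m2[of "max m1 m2"] by (auto simp: V_def)
  have comm: "x \<otimes> (inv a \<otimes> inv b \<otimes> a \<otimes> b) \<in> V"
    if x: "x \<in> V" and ab: "a \<in> root_span (levi_roots p)" "b \<in> root_span (levi_roots q)"
      and pq: "p = 1 \<or> p = n" "q = 1 \<or> q = n" for x a b p q
  proof -
    have "inv a \<in> root_span (levi_roots p)" "inv b \<in> root_span (levi_roots q)"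
      using ab subgroup.m_inv_closed[OF root_span_subgroup[OF root_sets(1)]] by auto
    then have "x \<otimes> inv a \<otimes> inv b \<otimes> a \<otimes> b \<in> V"
      using x ab pq by (intro step) auto
    moreover have "x \<in> carrier G" "a \<in> carrier G" "b \<in> carrier G"
      using x VG ab root_span_carrier[OF root_sets(1)] by auto
    ultimately show ?thesis
      by (simp add: m_assoc)
  qed
  have gen: "x \<otimes> c \<in> V" if x: "x \<in> V" and c: "c \<in> elems roots" for x c
  proof -
    obtain i j where ij: "(i, j) \<in> roots" "c \<in> U i j"
      using c by (auto simp: elems_def)
    have lev: "(1, 2) \<in> levi_roots n" "(2, n) \<in> levi_roots 1" "(n, 2) \<in> levi_roots 1"
      "(2, 1) \<in> levi_roots n"
      using n_ge_3 by (auto simp: levi_roots_def roots_def)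
    \<comment> \<open>Only the corner roots between \<open>1\<close> and \<open>n\<close> avoid both
      Levi factors. They are commutators through the index \<open>2\<close>, with one entry from
      each factor.\<close>
    have "i \<noteq> 1 \<and> j \<noteq> 1 \<or> i \<noteq> n \<and> j \<noteq> n \<or> i = 1 \<and> j = n \<or> i = n \<and> j = 1"
      using ij(1) by (auto simp: roots_def)
    then consider "(i, j) \<in> levi_roots 1" | "(i, j) \<in> levi_roots n" | "i = 1" "j = n" | "i = n" "j = 1"
      using ij(1) unfolding levi_roots_def by blast
    then show ?thesis
    proof cases
      case 1
      then show ?thesis
        using x root_elem_span[OF _ ij(2)] by (intro step) auto
    next
      case 2
      then show ?thesis
        using x root_elem_span[OF _ ij(2)] by (intro step) auto
    next
      case 3
      then obtain a b where "a \<in> U 1 2" "b \<in> U 2 n" "c = inv a \<otimes> inv b \<otimes> a \<otimes> b"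
        using comm_ex[of 1 2 n c] ij n n_ge_3 by auto
      then show ?thesis
        using comm[OF x root_elem_span[OF lev(1)] root_elem_span[OF lev(2)]] by simp
    next
      case 4
      then obtain a b where "a \<in> U n 2" "b \<in> U 2 1" "c = inv a \<otimes> inv b \<otimes> a \<otimes> b"
        using comm_ex[of n 2 1 c] ij n n_ge_3 by auto
      then show ?thesis
        using comm[OF x root_elem_span[OF lev(3)] root_elem_span[OF lev(4)]] by simp
    qed
  qed
  have closed: "x \<otimes> g \<in> V" if "g \<in> root_span roots" "x \<in> V" for g x
    using that unfolding root_span_def
  proof (induction arbitrary: x rule: generate.induct)
    case one
    then show ?case
      using VG by auto
  next
    case (incl h)
    then show ?case
      by (simp add: gen)
  next
    case (inv h)
    then show ?case
      by (simp add: gen elems_inv)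
  next
    case (eng g h)
    have "g \<in> carrier G" "h \<in> carrier G" "x \<in> carrier G"
      using eng VG generate_in_carrier[OF elems_carrier[OF subset_refl]] by auto
    then have "x \<otimes> (g \<otimes> h) = x \<otimes> g \<otimes> h"
      by (simp add: m_assoc)
    then show ?case
      using eng by simp
  qed
  have "\<one> \<in> V"
    unfolding V_def
    using alt_prod_mono[OF root_span_subgroup[OF triangular_roots(1)]
        root_span_subgroup[OF triangular_roots(2)], of 0] by auto
  then have "root_span roots \<subseteq> V"
    using closed[of _ \<one>] root_span_carrier[OF subset_refl] by fastforce
  moreover have "finite V"
    unfolding V_def
    by (intro finite_alt_prod finite_root_span_triangular[of n "col_roots n"]
        finite_root_span_triangular[of n "row_roots n"])
      (use n in \<open>auto simp: row_roots_def col_roots_def upper_roots_def lower_roots_def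
        levi_roots_def roots_def\<close>)
  ultimately show ?thesis
    by (rule finite_subset)
qed

end

section \<open>CAT(0) geometry\<close>

text \<open>Put one vertex at the origin and the second on the first axis; the law of cosines gives
  the coordinates of the third.\<close>

lemma ex_comparison_triangle:
  fixes a b c :: real
  assumes "a \<ge> 0" "b \<ge> 0" "c \<ge> 0" "a \<le> b + c" "b \<le> c + a" "c \<le> a + b"
  shows "\<exists>x y z :: real ^ 2. dist x y = c \<and> dist y z = a \<and> dist z x = b"
proof (cases "c = 0")
  case True
  then have "a = b"
    using assms by simp
  then show ?thesis
    using True assms
    by (intro exI[of _ 0] exI[of _ "vector [a, 0] :: real ^ 2"])
      (simp add: dist_norm norm_vec_def L2_set_def sum_2)
next
  case False
  then have c: "c > 0"
    using assms by simp
  define u where "u = (b\<^sup>2 + c\<^sup>2 - a\<^sup>2) / (2 * c)"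
  define v where "v = sqrt (b\<^sup>2 - u\<^sup>2)"
  have uc: "2 * c * u = b\<^sup>2 + c\<^sup>2 - a\<^sup>2"
    using c by (simp add: u_def)
  \<comment> \<open>The triangle inequalities say exactly that the projection \<open>u\<close> has
    length at most \<open>b\<close>, so \<open>v\<close> is the root of a nonnegative
    number.\<close>
  have "a\<^sup>2 \<le> (b + c)\<^sup>2" "(b - c)\<^sup>2 \<le> a\<^sup>2"
    using assms by (auto intro!: power_mono simp: abs_le_square_iff[symmetric] abs_if)
  then have "\<bar>b\<^sup>2 + c\<^sup>2 - a\<^sup>2\<bar> \<le> 2 * c * b"
    by (simp add: power2_eq_square algebra_simps)
  then have "2 * c * \<bar>u\<bar> \<le> 2 * c * b"
    using uc c by (metis abs_mult abs_of_pos mult_pos_pos zero_less_numeral)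
  then have "\<bar>u\<bar> \<le> \<bar>b\<bar>"
    using c assms by simp
  then have v: "v\<^sup>2 = b\<^sup>2 - u\<^sup>2"
    by (simp add: v_def abs_le_square_iff)
  have "(c - u)\<^sup>2 + v\<^sup>2 = a\<^sup>2"
    using uc v by (simp add: power2_eq_square algebra_simps)
  moreover have "u\<^sup>2 + v\<^sup>2 = b\<^sup>2"
    using v by simp
  ultimately show ?thesis
    using assms
    by (intro exI[of _ "0 :: real ^ 2"] exI[of _ "vector [c, 0] :: real ^ 2"]
        exI[of _ "vector [u, v] :: real ^ 2"])
      (simp add: dist_norm norm_vec_def L2_set_def sum_2)
qed

text \<open>Apollonius' theorem on medians, the Euclidean case of equality of the inequality
  below.\<close>

lemma dist_midpoint_power2:
  fixes x y z :: "'a::real_inner"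
  shows "(dist (midpoint x y) z)\<^sup>2 = (dist z x)\<^sup>2 / 2 + (dist z y)\<^sup>2 / 2 - (dist x y)\<^sup>2 / 4"
  unfolding dist_norm power2_norm_eq_inner midpoint_def
  by (simp add: algebra_simps inner_commute) (simp add: field_simps)

text \<open>This inequality of Bruhat and Tits is the only consequence of the CAT(0) condition used below.\<close>

lemma CAT0_midpoint:
  assumes "CAT0_space M d" and x: "x \<in> M" and y: "y \<in> M"
  shows "\<exists>m\<in>M. \<forall>z\<in>M. (d z m)\<^sup>2 \<le> (d z x)\<^sup>2 / 2 + (d z y)\<^sup>2 / 2 - (d x y)\<^sup>2 / 4"
proof -
  have M: "Metric_space M d"
    and ex: "\<And>x y. x \<in> M \<Longrightarrow> y \<in> M \<Longrightarrow> \<exists>S. geodesic_segment M d x y S"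
    and tri: "\<And>a b c A B C. a \<in> M \<Longrightarrow> b \<in> M \<Longrightarrow> c \<in> M \<Longrightarrow> geodesic_segment M d b c A \<Longrightarrow>
      geodesic_segment M d c a B \<Longrightarrow> geodesic_segment M d a b C \<Longrightarrow> CAT0_triangle d a b c A B C"
    using assms(1) unfolding CAT0_space_def by blast+
  interpret Metric_space M d
    by fact
  obtain C where C: "geodesic_segment M d x y C"
    using ex[OF x y] ..
  then obtain \<gamma> where \<gamma>: "\<gamma> \<in> {0..d x y} \<rightarrow> M" "\<gamma> 0 = x"
    "\<And>s t. s \<in> {0..d x y} \<Longrightarrow> t \<in> {0..d x y} \<Longrightarrow> d (\<gamma> s) (\<gamma> t) = \<bar>s - t\<bar>" "C = \<gamma> ` {0..d x y}"
    unfolding geodesic_segment_def by blast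
  define m where "m = \<gamma> (d x y / 2)"
  have half: "d x y / 2 \<in> {0..d x y}" "0 \<in> {0..d x y}"
    by auto
  have m: "m \<in> M" "m \<in> C"
    using \<gamma>(1,4) half(1) by (auto simp: m_def)
  have xm: "d x m = d x y / 2"
    using \<gamma>(3)[OF half(2,1)] \<gamma>(2) by (simp add: m_def)
  have "(d z m)\<^sup>2 \<le> (d z x)\<^sup>2 / 2 + (d z y)\<^sup>2 / 2 - (d x y)\<^sup>2 / 4" if z: "z \<in> M" for z
  proof -
    obtain A where A: "geodesic_segment M d y z A"
      using ex[OF y z] ..
    obtain B where B: "geodesic_segment M d z x B"
      using ex[OF z x] ..
    \<comment> \<open>The vertex \<open>z\<close> serves as a point of the side \<open>B\<close>, so
      that comparison of points on two sides covers the median from \<open>z\<close>.\<close>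
    have zB: "z \<in> B"
      using B unfolding geodesic_segment_def by force
    obtain x' y' z' :: "real ^ 2" where
      dists: "dist x' y' = d x y" "dist y' z' = d y z" "dist z' x' = d z x"
      using ex_comparison_triangle[of "d y z" "d z x" "d x y"]
        triangle[OF x y z] triangle[OF y z x] triangle[OF z x y] commute
      by (metis nonneg)
    have "comparison_point d x x' y' m (midpoint x' y')"
      using dists xm by (simp add: comparison_point_def dist_midpoint)
    moreover have "comparison_point d z z' x' z z'"
      using z by (simp add: comparison_point_def)
    \<comment> \<open>In the comparison condition, \<open>bspec\<close> selects side
      \<open>C\<close> for \<open>m\<close>, and the last conjunct selects side \<open>B\<close> for
      \<open>z\<close>.\<close>
    ultimately have "d m z \<le> dist (midpoint x' y') z'"
      using tri[OF x y z A B C, unfolded CAT0_triangle_def Let_def, THEN spec, THEN spec, THEN spec,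
          THEN mp, of x' y' z', THEN bspec, of "(x, x', y', C)", simplified, THEN conjunct2,
          THEN conjunct2] dists m(2) zB by simp
    then have "(d z m)\<^sup>2 \<le> (dist (midpoint x' y') z')\<^sup>2"
      by (simp add: commute power_mono)
    also have "\<dots> = (d z x)\<^sup>2 / 2 + (d z y)\<^sup>2 / 2 - (d x y)\<^sup>2 / 4"
      unfolding dist_midpoint_power2 using dists by (simp add: dist_commute commute)
    finally show ?thesis .
  qed
  then show ?thesis
    using m(1) by blast
qed

section \<open>Displacement\<close>

locale isometric_group_action = Metric_space M d + group H
  for M :: "'x set" and d :: "'x \<Rightarrow> 'x \<Rightarrow> real" and H :: "('h, 'm) monoid_scheme" (structure) +
  fixes \<alpha> :: "'h \<Rightarrow> 'x \<Rightarrow> 'x"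
  assumes isometric: "isometric_action H M d \<alpha>"
begin

sublocale group_action H M \<alpha>
  using isometric by (simp add: isometric_action_def)

lemma act_closed [simp]: "g \<in> carrier H \<Longrightarrow> x \<in> M \<Longrightarrow> \<alpha> g x \<in> M"
  by (rule element_image) auto

lemma act_one [simp]: "x \<in> M \<Longrightarrow> \<alpha> \<one> x = x"
  using id_eq_one by (metis restrict_apply')

lemma act_inv_act [simp]: "g \<in> carrier H \<Longrightarrow> x \<in> M \<Longrightarrow> \<alpha> (inv g) (\<alpha> g x) = x"
  by (simp flip: composition_rule)

lemma act_act_inv [simp]: "g \<in> carrier H \<Longrightarrow> x \<in> M \<Longrightarrow> \<alpha> g (\<alpha> (inv g) x) = x"
  by (simp flip: composition_rule)

lemma dist_act [simp]:
  "g \<in> carrier H \<Longrightarrow> x \<in> M \<Longrightarrow> y \<in> M \<Longrightarrow> d (\<alpha> g x) (\<alpha> g y) = d x y"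
  using isometric by (simp add: isometric_action_def)

lemma dist_act_inv:
  assumes "g \<in> carrier H" "x \<in> M" "y \<in> M"
  shows "d (\<alpha> (inv g) x) y = d x (\<alpha> g y)" "d y (\<alpha> (inv g) x) = d x (\<alpha> g y)"
  using dist_act[of g "\<alpha> (inv g) x" y] assms by (simp_all add: commute)

definition disp :: "'h \<Rightarrow> 'x \<Rightarrow> real"
  where "disp g x = d (\<alpha> g x) x"

lemma disp_nonneg [simp]: "disp g x \<ge> 0"
  by (simp add: disp_def)

lemma disp_mult:
  assumes "g \<in> carrier H" "h \<in> carrier H" "x \<in> M"
  shows "disp (g \<otimes> h) x \<le> disp g x + disp h x"
  using triangle[of "\<alpha> g (\<alpha> h x)" "\<alpha> g x" x] assms by (simp add: disp_def composition_rule)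

lemma disp_inv: "g \<in> carrier H \<Longrightarrow> x \<in> M \<Longrightarrow> disp (inv g) x = disp g x"
  by (simp add: disp_def dist_act_inv commute)

lemma disp_pow:
  fixes m :: nat
  assumes "g \<in> carrier H" "x \<in> M"
  shows "disp (g [^] m) x \<le> m * disp g x"
proof (induction m)
  case 0
  then show ?case
    using assms by (simp add: disp_def)
next
  case (Suc m)
  then show ?case
    using disp_mult[of "g [^] m" g x] assms by (simp add: algebra_simps)
qed

end

section \<open>Displacement under geometric actions on CAT(0) spaces\<close>

locale geometric_action = isometric_group_action +
  assumes CAT0: "CAT0_space M d"
    and proper: "proper_action H M d \<alpha>"
    and cocompact: "cocompact_action H M d \<alpha>"
begin

text \<open>Take \<open>m\<close> midway between \<open>x\<close> and its image under
  \<open>g\<close>. Then \<open>m\<close> and its image are midpoints of two sides of the triangle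
  formed by \<open>x\<close> and its images under \<open>g\<close> and \<open>g \<otimes> g\<close>,
  so their distance is at most half the third side.\<close>

lemma disp_midpoint:
  assumes g: "g \<in> carrier H" and x: "x \<in> M"
  shows "\<exists>m\<in>M. 2 * disp g m \<le> disp (g \<otimes> g) x"
proof -
  let ?y = "\<alpha> g x" and ?z = "\<alpha> g (\<alpha> g x)"
  obtain m where m: "m \<in> M"
    and *: "\<And>z. z \<in> M \<Longrightarrow> (d z m)\<^sup>2 \<le> (d z x)\<^sup>2 / 2 + (d z ?y)\<^sup>2 / 2 - (d x ?y)\<^sup>2 / 4"
    using CAT0_midpoint[OF CAT0 x, of ?y] g x by auto
  have 1: "(d ?y m)\<^sup>2 \<le> (d x ?y)\<^sup>2 / 4"
    using *[of ?y] g x by (simp add: commute)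
  have 2: "(d ?z m)\<^sup>2 \<le> (d ?z x)\<^sup>2 / 2 + (d x ?y)\<^sup>2 / 4"
    using *[of ?z] g x by (simp add: commute)
  \<comment> \<open>The inequality is used at \<open>\<alpha> (inv g) m\<close>, and all distances
    are then transported by \<open>g\<close>.\<close>
  have 3: "(d m (\<alpha> g m))\<^sup>2 \<le> (d ?y m)\<^sup>2 / 2 + (d ?z m)\<^sup>2 / 2 - (d x ?y)\<^sup>2 / 4"
    using *[of "\<alpha> (inv g) m"] g x m by (simp add: dist_act_inv commute)
  have "(2 * d m (\<alpha> g m))\<^sup>2 \<le> (d ?z x)\<^sup>2"
    using 1 2 3 by (simp add: power_mult_distrib)
  then have "2 * d m (\<alpha> g m) \<le> d ?z x"
    by (rule power2_le_imp_le) simp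
  then show ?thesis
    using m g x by (intro bexI[of _ m]) (simp_all add: disp_def composition_rule commute)
qed

text \<open>Iterated halving along repeated squares. A bound for a high power at one point becomes a
  bound for \<open>g\<close> itself at another point, which may depend on \<open>k\<close>.\<close>

lemma disp_pow_two_power:
  assumes "g \<in> carrier H" "x \<in> M"
  shows "\<exists>y\<in>M. 2 ^ k * disp g y \<le> disp (g [^] (2 ^ k :: nat)) x"
  using assms(1)
proof (induction k arbitrary: g)
  case 0
  then show ?case
    using assms(2) by auto
next
  case (Suc k)
  then have sq: "(g \<otimes> g) [^] (2 ^ k :: nat) = g [^] (2 ^ Suc k :: nat)"
    by (metis nat_pow_eone nat_pow_mult nat_pow_pow one_add_one power_Suc)
  obtain y where y: "y \<in> M" "2 ^ k * disp (g \<otimes> g) y \<le> disp ((g \<otimes> g) [^] (2 ^ k :: nat)) x"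
    using Suc.IH[of "g \<otimes> g"] Suc.prems by blast
  obtain m where m: "m \<in> M" "2 * disp g m \<le> disp (g \<otimes> g) y"
    using disp_midpoint[OF Suc.prems y(1)] by blast
  have "2 ^ Suc k * disp g m = 2 ^ k * (2 * disp g m)"
    by simp
  also have "\<dots> \<le> 2 ^ k * disp (g \<otimes> g) y"
    using m(2) by (rule mult_left_mono) simp
  also have "\<dots> \<le> disp (g [^] (2 ^ Suc k :: nat)) x"
    using y(2) unfolding sq .
  finally show ?case
    using m(1) by blast
qed

text \<open>A Lebesgue number argument: finitely many balls of half the radius of properness cover
  \<open>K\<close>, and \<epsilon> is at most each half radius. Moving \<open>x\<close> into
  \<open>K\<close> conjugates the elements of small displacement into one of the finite sets
  \<open>F y\<close>, so the bound is uniform in \<open>x\<close>.\<close>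

lemma ex_displacement_bound:
  "\<exists>\<epsilon>>0. \<exists>B. \<forall>x\<in>M. finite {g \<in> carrier H. disp g x < \<epsilon>} \<and> card {g \<in> carrier H. disp g x < \<epsilon>} \<le> B"
proof -
  obtain K where K: "compactin mtopology K" "(\<Union>g\<in>carrier H. \<alpha> g ` K) = M"
    using cocompact unfolding cocompact_action_def by (elim exE conjE)
  have KM: "K \<subseteq> M"
    using compactin_subset_topspace[OF K(1)] by simp
  have "\<forall>y\<in>M. \<exists>r>0. finite {g \<in> carrier H. \<alpha> g ` mball y r \<inter> mball y r \<noteq> {}}"
    using proper unfolding proper_action_def .
  then obtain r where r: "r y > 0" "finite {g \<in> carrier H. \<alpha> g ` mball y (r y) \<inter> mball y (r y) \<noteq> {}}"
    if "y \<in> M" for y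
    unfolding Bex_def bchoice_iff by blast
  define F where "F y = {g \<in> carrier H. \<alpha> g ` mball y (r y) \<inter> mball y (r y) \<noteq> {}}" for y
  have finF: "finite (F y)" if "y \<in> M" for y
    using r(2)[OF that] by (simp add: F_def)
  have "y \<in> mball y (r y / 2)" if "y \<in> K" for y
    using that KM r(1)[of y] by (simp add: subset_iff)
  then have cover: "K \<subseteq> \<Union> ((\<lambda>y. mball y (r y / 2)) ` K)"
    by blast
  have "openin mtopology U" if "U \<in> (\<lambda>y. mball y (r y / 2)) ` K" for U
    using that by auto
  then have "\<exists>\<F>. finite \<F> \<and> \<F> \<subseteq> (\<lambda>y. mball y (r y / 2)) ` K \<and> K \<subseteq> \<Union> \<F>"
    by (rule compactinD[OF K(1) _ cover])
  then obtain \<F> where \<F>: "finite \<F>" "\<F> \<subseteq> (\<lambda>y. mball y (r y / 2)) ` K" "K \<subseteq> \<Union> \<F>"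
    by (elim exE conjE)
  obtain Y where Y: "Y \<subseteq> K" "finite Y" "\<F> = (\<lambda>y. mball y (r y / 2)) ` Y"
    using finite_subset_image[OF \<F>(1,2)] by (elim exE conjE)
  have KY: "K \<subseteq> (\<Union>y\<in>Y. mball y (r y / 2))"
    using \<F>(3) unfolding Y(3) .
  \<comment> \<open>\<open>insert 1\<close> keeps the minimum meaningful when \<open>Y\<close> is
    empty.\<close>
  define \<epsilon> where "\<epsilon> = Min (insert 1 ((\<lambda>y. r y / 2) ` Y))"
  define B where "B = (\<Sum>y\<in>Y. card (F y))"
  have "\<epsilon> > 0"
    unfolding \<epsilon>_def using Y(1,2) KM r(1) by (subst Min_gr_iff) auto
  moreover have "finite {g \<in> carrier H. disp g x < \<epsilon>} \<and> card {g \<in> carrier H. disp g x < \<epsilon>} \<le> B"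
    if x: "x \<in> M" for x
  proof -
    obtain h z where h: "h \<in> carrier H" "z \<in> K" "x = \<alpha> h z"
      using x unfolding K(2)[symmetric] by blast
    obtain y where y: "y \<in> Y" "z \<in> mball y (r y / 2)"
      using KY h(2) by blast
    have yz: "y \<in> M" "z \<in> M" "d y z < r y / 2"
      using y KM Y(1) by auto
    have "\<epsilon> \<le> r y / 2"
      unfolding \<epsilon>_def using Y(2) y(1) by (intro Min_le) auto
    have sub: "(\<lambda>g. inv h \<otimes> g \<otimes> h) ` {g \<in> carrier H. disp g x < \<epsilon>} \<subseteq> F y"
    proof (rule image_subsetI)
      fix g assume "g \<in> {g \<in> carrier H. disp g x < \<epsilon>}"
      then have g: "g \<in> carrier H" "disp g x < \<epsilon>"
        by auto
      let ?g = "inv h \<otimes> g \<otimes> h"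
      have "d (\<alpha> ?g z) z = disp g x"
        using g h yz by (simp add: composition_rule dist_act_inv disp_def)
      then have "d y (\<alpha> ?g z) < r y"
        using triangle[of y z "\<alpha> ?g z"] g h yz \<open>\<epsilon> \<le> r y / 2\<close> by (simp add: commute)
      moreover have "d y z < r y"
        using yz r(1)[of y] by simp
      ultimately have "\<alpha> ?g z \<in> mball y (r y)" "z \<in> mball y (r y)"
        using yz g h by auto
      then have "\<alpha> ?g z \<in> \<alpha> ?g ` mball y (r y) \<inter> mball y (r y)"
        by (intro IntI imageI)
      moreover have "?g \<in> carrier H"
        using g h by simp
      ultimately show "?g \<in> F y"
        unfolding F_def by blast
    qed
    have inj: "inj_on (\<lambda>g. inv h \<otimes> g \<otimes> h) {g \<in> carrier H. disp g x < \<epsilon>}"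
      using h(1) by (intro inj_onI) simp
    have "card (F y) \<le> B"
      unfolding B_def using Y(2) y(1) by (intro member_le_sum) auto
    then show ?thesis
      using inj_on_finite[OF inj sub] card_inj_on_le[OF inj sub] finF[OF yz(1)] by simp
  qed
  ultimately show ?thesis
    by (intro exI[of _ \<epsilon>] exI[of _ B] conjI ballI) simp_all
qed

text \<open>The hypothesis forces translation length zero.\<close>

lemma finite_order_if_sqrt_growth:
  fixes C :: real
  assumes c: "c \<in> carrier H" and x: "x \<in> M"
    and growth: "\<And>m. disp (c [^] (m * m :: nat)) x \<le> C * m"
  shows "\<exists>m>0. c [^] (m::nat) = \<one>"
proof -
  obtain \<epsilon> B where \<epsilon>: "\<epsilon> > 0" and "\<forall>x\<in>M. finite {g \<in> carrier H. disp g x < \<epsilon>} \<and>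
      card {g \<in> carrier H. disp g x < \<epsilon>} \<le> B"
    using ex_displacement_bound by (elim exE conjE)
  then have B: "finite {g \<in> carrier H. disp g x < \<epsilon>}" "card {g \<in> carrier H. disp g x < \<epsilon>} \<le> B"
    if "x \<in> M" for x
    using that by simp_all
  \<comment> \<open>Chosen to bring the displacement of \<open>c\<close> at some point below
    \<epsilon> divided by \<open>B + 1\<close>, which leaves room for \<open>B + 1\<close>
    powers.\<close>
  obtain k :: nat where "C * (B + 1) / \<epsilon> < 2 ^ k"
    using real_arch_pow[of 2] by auto
  then have k: "C * (B + 1) < 2 ^ k * \<epsilon>"
    using \<epsilon> by (simp add: field_simps)
  \<comment> \<open>The exponent \<open>2 ^ (k + k)\<close> is a power of two, as halving requires,
    and the square of \<open>2 ^ k\<close>, as \<open>growth\<close> requires.\<close>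
  obtain y where y: "y \<in> M" "2 ^ (k + k) * disp c y \<le> disp (c [^] (2 ^ (k + k) :: nat)) x"
    using disp_pow_two_power[OF c x] by blast
  have "disp (c [^] (2 ^ (k + k) :: nat)) x \<le> C * 2 ^ k"
    using growth[of "2 ^ k"] by (simp add: power_add)
  from order_trans[OF y(2) this] have "2 ^ k * (2 ^ k * disp c y) \<le> 2 ^ k * C"
    by (simp add: power_add mult_ac)
  then have "2 ^ k * disp c y \<le> C"
    by simp
  then have "(2 ^ k * disp c y) * (B + 1) \<le> C * (B + 1)"
    by (intro mult_right_mono) auto
  with k have "2 ^ k * (disp c y * (B + 1)) < 2 ^ k * \<epsilon>"
    by (simp only: mult.assoc)
  then have small: "disp c y * (B + 1) < \<epsilon>"
    by (rule mult_left_less_imp_less) simp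
  \<comment> \<open>The exponents from \<open>0\<close> to \<open>B\<close> are \<open>B + 1\<close>
    in number, one more than the set can hold, so two powers coincide.\<close>
  have "(\<lambda>j. c [^] j) ` {0..B} \<subseteq> {g \<in> carrier H. disp g y < \<epsilon>}"
  proof safe
    fix j assume "j \<in> {0..B}"
    then have "real j * disp c y \<le> (B + 1) * disp c y"
      by (intro mult_right_mono) auto
    then show "disp (c [^] j) y < \<epsilon>"
      using disp_pow[OF c y(1), of j] small by (simp add: mult_ac)
  qed (use c in simp)
  then have "card ((\<lambda>j. c [^] j) ` {0..B}) \<le> B"
    using card_mono[OF B(1)[OF y(1)]] B(2)[OF y(1)] order_trans by blast
  then have "\<not> inj_on (\<lambda>j. c [^] j) {0..B}"
    by (auto dest: card_image)
  then obtain i j :: nat where "i < j" "c [^] i = c [^] j"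
    unfolding inj_on_def by (metis linorder_neqE_nat)
  have "c [^] i \<otimes> c [^] (j - i) = c [^] j"
    using c \<open>i < j\<close> by (simp add: nat_pow_mult)
  then have "c [^] i \<otimes> c [^] (j - i) = c [^] i \<otimes> \<one>"
    using c \<open>c [^] i = c [^] j\<close> by simp
  then have "c [^] (j - i) = \<one>"
    using c by (metis l_cancel nat_pow_closed one_closed)
  then show ?thesis
    using \<open>i < j\<close> by (intro exI[of _ "j - i"]) simp
qed

text \<open>
  A finite subgroup moves an approximate minimiser of the sum of squared distances to one of its
  orbits only a little. Working with approximate minimisers avoids completeness of \<open>M\<close>, which
  Cartan's fixed point theorem would need.
\<close>

lemma finite_subgroup_bound:
  assumes "M \<noteq> {}"
  shows "\<exists>B. \<forall>F. subgroup F H \<and> finite F \<longrightarrow> card F \<le> B"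
proof -
  obtain \<epsilon> B where \<epsilon>: "\<epsilon> > 0" and "\<forall>x\<in>M. finite {g \<in> carrier H. disp g x < \<epsilon>} \<and>
      card {g \<in> carrier H. disp g x < \<epsilon>} \<le> B"
    using ex_displacement_bound by (elim exE conjE)
  then have B: "finite {g \<in> carrier H. disp g x < \<epsilon>}" "card {g \<in> carrier H. disp g x < \<epsilon>} \<le> B"
    if "x \<in> M" for x
    using that by simp_all
  obtain x\<^sub>0 where x\<^sub>0: "x\<^sub>0 \<in> M"
    using assms by blast
  have "card F \<le> B" if F: "subgroup F H" and fin: "finite F" for F
  proof -
    note carr = subgroup.mem_carrier[OF F]
    define \<Phi> where "\<Phi> p = (\<Sum>h\<in>F. (d p (\<alpha> h x\<^sub>0))\<^sup>2)" for p
    \<comment> \<open>Any \<delta> with \<open>4 * \<delta> < \<epsilon>\<^sup>2\<close>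
      serves.\<close>
    define \<delta> where "\<delta> = \<epsilon>\<^sup>2 / 5"
    have \<delta>: "\<delta> > 0"
      using \<epsilon> by (simp add: \<delta>_def)
    have bdd: "bdd_below (\<Phi> ` M)"
      unfolding \<Phi>_def by (intro bdd_belowI2[of _ 0] sum_nonneg) simp
    obtain p where p: "p \<in> M" "\<Phi> p < Inf (\<Phi> ` M) + \<delta>"
      using cInf_lessD[of "\<Phi> ` M" "Inf (\<Phi> ` M) + \<delta>"] assms \<delta> by auto
    have "F \<subseteq> {g \<in> carrier H. disp g p < \<epsilon>}"
    proof
      fix g assume gF: "g \<in> F"
      note g = carr[OF gF]
      \<comment> \<open>Left multiplication by \<open>g\<close> permutes \<open>F\<close>, hence
        only reorders the summands.\<close>
      have inv: "\<Phi> (\<alpha> g p) = \<Phi> p"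
        unfolding \<Phi>_def
      proof (rule sum.reindex_bij_witness[of _ "\<lambda>h. g \<otimes> h" "\<lambda>h. inv g \<otimes> h"])
        fix h assume "h \<in> F"
        then show "(d p (\<alpha> (inv g \<otimes> h) x\<^sub>0))\<^sup>2 = (d (\<alpha> g p) (\<alpha> h x\<^sub>0))\<^sup>2"
          using g carr[of h] x\<^sub>0 p by (simp add: composition_rule dist_act_inv commute)
      qed (simp_all add: g carr gF subgroup.m_closed[OF F] subgroup.m_inv_closed[OF F])
      obtain m where m: "m \<in> M" "\<And>z. z \<in> M \<Longrightarrow>
          (d z m)\<^sup>2 \<le> (d z p)\<^sup>2 / 2 + (d z (\<alpha> g p))\<^sup>2 / 2 - (d p (\<alpha> g p))\<^sup>2 / 4"
        using CAT0_midpoint[OF CAT0 p(1), of "\<alpha> g p"] g p by auto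
      have "\<Phi> m \<le> (\<Sum>h\<in>F. (d p (\<alpha> h x\<^sub>0))\<^sup>2 / 2 + (d (\<alpha> g p) (\<alpha> h x\<^sub>0))\<^sup>2 / 2 - (d p (\<alpha> g p))\<^sup>2 / 4)"
        unfolding \<Phi>_def
      proof (rule sum_mono)
        fix h assume "h \<in> F"
        then show "(d m (\<alpha> h x\<^sub>0))\<^sup>2
          \<le> (d p (\<alpha> h x\<^sub>0))\<^sup>2 / 2 + (d (\<alpha> g p) (\<alpha> h x\<^sub>0))\<^sup>2 / 2 - (d p (\<alpha> g p))\<^sup>2 / 4"
          using m(2)[of "\<alpha> h x\<^sub>0"] carr x\<^sub>0 by (simp add: commute)
      qed
      also have "\<dots> = \<Phi> p / 2 + \<Phi> (\<alpha> g p) / 2 - card F * ((d p (\<alpha> g p))\<^sup>2 / 4)"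
        unfolding \<Phi>_def by (simp only: sum.distrib sum_subtractf sum_divide_distrib sum_constant)
      also have "\<dots> = \<Phi> p - card F * ((disp g p)\<^sup>2 / 4)"
        unfolding inv disp_def by (simp add: commute)
      \<comment> \<open>As \<open>p\<close> is within \<delta> of the infimum, the gain at the
        midpoint is less than \<delta>; \<open>card F \<ge> 1\<close> then bounds the displacement
        itself.\<close>
      finally have "\<Phi> m \<le> \<Phi> p - card F * ((disp g p)\<^sup>2 / 4)" .
      moreover have "Inf (\<Phi> ` M) \<le> \<Phi> m"
        using bdd m(1) by (intro cInf_lower) auto
      moreover have "card F \<ge> 1"
        using card_mono[OF fin, of "{g}"] gF by simp
      then have "1 * ((disp g p)\<^sup>2 / 4) \<le> card F * ((disp g p)\<^sup>2 / 4)"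
        by (intro mult_right_mono) auto
      ultimately have "(disp g p)\<^sup>2 \<le> 4 * \<delta>"
        using p(2) by linarith
      also have "\<dots> < \<epsilon>\<^sup>2"
        using \<epsilon> by (simp add: \<delta>_def)
      finally have "disp g p < \<epsilon>"
        by (rule power2_less_imp_less) (use \<epsilon> in simp)
      then show "g \<in> {g \<in> carrier H. disp g p < \<epsilon>}"
        using g by simp
    qed
    from card_mono[OF B(1)[OF p(1)] this] B(2)[OF p(1)] show ?thesis
      by (rule order_trans)
  qed
  then show ?thesis
    by (intro exI[of _ B]) simp
qed

end

section \<open>Torsion of central commutators\<close>

text \<open>A Heisenberg group computation: conjugation by \<open>b [^] m\<close> multiplies
  \<open>a\<close> by \<open>c [^] m\<close>, and raising to the power \<open>m\<close> squares the
  exponent because \<open>a\<close> commutes with \<open>c\<close>.\<close>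

lemma (in group) commutator_pow:
  fixes m :: nat
  assumes a: "a \<in> carrier G" and b: "b \<in> carrier G"
    and c: "c = inv a \<otimes> inv b \<otimes> a \<otimes> b" and ac: "a \<otimes> c = c \<otimes> a" and bc: "b \<otimes> c = c \<otimes> b"
  shows "c [^] (m * m) = inv (a [^] m) \<otimes> inv (b [^] m) \<otimes> a [^] m \<otimes> b [^] m"
proof -
  have cG: "c \<in> carrier G"
    using a b c by simp
  have conj_a: "conj_by b a = a \<otimes> c"
    using a b by (simp add: c conj_by_def m_assoc)
  have conj_c: "conj_by b c = c"
    using b cG bc by (simp add: conj_by_eq_iff_commute)
  have "conj_by (b [^] k) a = a \<otimes> c [^] k" for k :: nat
  proof (induction k)
    case 0
    then show ?case
      using a by simp
  next
    case (Suc k)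
    have "conj_by (b [^] Suc k) a = conj_by b (conj_by (b [^] k) a)"
      using a b by (simp add: conj_by_conj_by)
    also have "\<dots> = a \<otimes> (c \<otimes> c [^] k)"
      using a b cG by (simp add: Suc conj_by_mult conj_by_pow conj_a conj_c m_assoc)
    also have "c \<otimes> c [^] k = c [^] Suc k"
      by (rule nat_pow_Suc2[OF cG, symmetric])
    finally show ?case .
  qed
  then have "conj_by (b [^] m) (a [^] m) = (a \<otimes> c [^] m) [^] m"
    using a b by (simp add: conj_by_pow)
  also have "\<dots> = a [^] m \<otimes> (c [^] m) [^] m"
  proof (rule pow_mult_distrib)
    have "conj_by a c = c"
      using a cG ac by (simp add: conj_by_eq_iff_commute)
    then have "conj_by a (c [^] m) = c [^] m"
      using a cG by (simp add: conj_by_pow)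
    then show "a \<otimes> c [^] m = c [^] m \<otimes> a"
      using a cG by (simp add: conj_by_eq_iff_commute)
  qed (use a cG in simp_all)
  finally have "inv (b [^] m) \<otimes> a [^] m \<otimes> b [^] m = a [^] m \<otimes> c [^] (m * m)"
    using cG by (simp add: conj_by_def nat_pow_pow)
  then have "inv (a [^] m) \<otimes> (inv (b [^] m) \<otimes> a [^] m \<otimes> b [^] m) = c [^] (m * m)"
    using a cG by simp
  then show ?thesis
    using a b by (simp add: m_assoc)
qed

text \<open>Quadratic distortion: \<open>c [^] (m * m)\<close> is a product of four factors whose
  displacements grow at most linearly in \<open>m\<close>.\<close>

lemma (in geometric_action) commutator_finite_order:
  assumes M: "M \<noteq> {}" and a: "a \<in> carrier H" and b: "b \<in> carrier H"
    and c: "c = inv a \<otimes> inv b \<otimes> a \<otimes> b" and comm: "a \<otimes> c = c \<otimes> a" "b \<otimes> c = c \<otimes> b"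
  shows "\<exists>m>0. c [^] (m::nat) = \<one>"
proof -
  obtain x where x: "x \<in> M"
    using M by blast
  have "disp (c [^] (m * m)) x \<le> (2 * disp a x + 2 * disp b x) * m" for m :: nat
  proof -
    let ?a = "a [^] m" and ?b = "b [^] m"
    have "disp (c [^] (m * m)) x \<le> disp (inv ?a \<otimes> inv ?b \<otimes> ?a) x + disp ?b x"
      unfolding commutator_pow[OF a b c comm] using a b x by (intro disp_mult) auto
    also have "disp (inv ?a \<otimes> inv ?b \<otimes> ?a) x \<le> disp (inv ?a \<otimes> inv ?b) x + disp ?a x"
      using a b x by (intro disp_mult) auto
    also have "disp (inv ?a \<otimes> inv ?b) x \<le> disp (inv ?a) x + disp (inv ?b) x"
      using a b x by (intro disp_mult) auto
    finally show ?thesis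
      using a b x disp_pow[OF a x, of m] disp_pow[OF b x, of m]
      by (simp add: disp_inv algebra_simps)
  qed
  moreover have "c \<in> carrier H"
    using a b c by simp
  ultimately show ?thesis
    using x by (intro finite_order_if_sqrt_growth)
qed

lemma (in geometric_action) finite_root_subgroups:
  assumes M: "M \<noteq> {}" and "root_subgroups H n U"
  shows "finite_root_subgroups H n U"
proof -
  interpret U: root_subgroups H n U
    by fact
  obtain B where B: "\<forall>F. subgroup F H \<and> finite F \<longrightarrow> card F \<le> B"
    using finite_subgroup_bound[OF M] ..
  show ?thesis
  proof unfold_locales
    fix i k assume ik: "(i, k) \<in> U.roots"
    show "finite (U i k)"
    proof (rule torsion_abelian_finite[OF U.subgroup_U'[OF ik], where B = B])
      show "x \<otimes> y = y \<otimes> x" if "x \<in> U i k" "y \<in> U i k" for x y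
        using that ik by (intro U.commute_U[of i k i k]) (auto simp: U.roots_def)
      show "card F \<le> B" if "subgroup F H" "finite F" for F
        using B that by simp
    next
      fix c assume cU: "c \<in> U i k"
      \<comment> \<open>Three indices are available, so some \<open>j\<close> lies outside
        \<open>{i, k}\<close>; the commutator is formed through it.\<close>
      have "card {i, k} < card {1..n}"
        using card_insert_le_m1[of 2 "{k}" i] U.n_ge_3 by simp
      then have "\<not> {1..n} \<subseteq> {i, k}"
        using card_mono[of "{i, k}" "{1..n}"] by auto
      then obtain j where j: "j \<in> {1..n}" "j \<noteq> i" "j \<noteq> k"
        by blast
      have r: "(i, j) \<in> U.roots" "(j, k) \<in> U.roots" "i \<noteq> k"
        using ik j by (auto simp: U.roots_def)
      obtain a b where ab: "a \<in> U i j" "b \<in> U j k" "c = inv a \<otimes> inv b \<otimes> a \<otimes> b"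
        using U.comm_ex[of i j k c] ik j cU by (auto simp: U.roots_def)
      show "\<exists>m>0. c [^] (m::nat) = \<one>"
      proof (rule commutator_finite_order[OF M _ _ ab(3)])
        show "a \<in> carrier H" "b \<in> carrier H"
          using U.U_carrier r ab by auto
        show "a \<otimes> c = c \<otimes> a"
          by (rule U.commute_U[OF r(1) ik _ _ ab(1) cU]) (use j r in auto)
        show "b \<otimes> c = c \<otimes> b"
          by (rule U.commute_U[OF r(2) ik _ _ ab(2) cU]) (use j r in auto)
      qed
    qed
  qed
qed

section \<open>Homomorphisms from Steinberg groups\<close>

locale presented_group_hom = group H for H (structure) +
  fixes S :: "'g set" and Rel :: "('g gword \<times> 'g gword) set" and \<phi> :: "'g gword set \<Rightarrow> 'a"
  assumes hom: "\<phi> \<in> hom (presented_group S Rel) H"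
begin

text \<open>The homomorphism lifted to words, so that relators can be evaluated in \<open>H\<close>
  without handling classes.\<close>

definition word_img :: "'g gword \<Rightarrow> 'a"
  where "word_img w = \<phi> (pres_rel S Rel `` {w})"

lemma carrier_presented_group:
  "carrier (presented_group S Rel) = (\<lambda>w. pres_rel S Rel `` {w}) ` gwords S"
  by (auto simp: presented_group_def quotient_def)

lemma word_img_closed [simp]: "w \<in> gwords S \<Longrightarrow> word_img w \<in> carrier H"
  using hom unfolding word_img_def hom_def carrier_presented_group by blast

lemma word_img_append:
  assumes "u \<in> gwords S" "v \<in> gwords S"
  shows "word_img (u @ v) = word_img u \<otimes> word_img v"
  using assms hom_mult[OF hom, of "pres_rel S Rel `` {u}" "pres_rel S Rel `` {v}"]
  by (simp add: word_img_def carrier_presented_group presented_group_mult)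

lemma word_img_eq:
  assumes "pres_eq S Rel u v"
  shows "word_img u = word_img v"
proof -
  have "pres_rel S Rel `` {u} = pres_rel S Rel `` {v}"
    by (rule equiv_class_eq[OF equiv_pres_rel]) (simp add: pres_rel_def assms)
  then show ?thesis
    by (simp add: word_img_def)
qed

lemma Nil_closed: "[] \<in> gwords S"
  by (simp add: gwords_def)

lemma word_img_Nil: "word_img [] = \<one>"
proof -
  note nil = Nil_closed
  then have "word_img [] \<otimes> word_img [] = word_img []"
    using word_img_append[OF nil nil] by simp
  then show ?thesis
    using nil by (simp add: r_cancel_one')
qed

lemma word_img_inv:
  assumes "w \<in> gwords S"
  shows "word_img (gword_inv w) = inv (word_img w)"
proof -
  have "word_img (gword_inv w) \<otimes> word_img w = \<one>"
    using word_img_append[OF gword_inv_closed[OF assms] assms]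
      word_img_eq[OF pres_eq_inv_left[OF assms]] word_img_Nil by simp
  then show ?thesis
    using assms gword_inv_closed[OF assms] by (intro inv_equality[symmetric]) auto
qed

lemma word_img_comm:
  assumes "u \<in> gwords S" "v \<in> gwords S"
  shows "word_img (gword_comm u v)
    = inv (word_img u) \<otimes> inv (word_img v) \<otimes> word_img u \<otimes> word_img v"
  using assms by (simp add: gword_comm_def word_img_append word_img_inv gword_inv_closed
      append_gwords_iff m_assoc)

lemma gword_comm_closed:
  "u \<in> gwords S \<Longrightarrow> v \<in> gwords S \<Longrightarrow> gword_comm u v \<in> gwords S"
  by (simp add: gword_comm_def gword_inv_closed append_gwords_iff)

lemma gen_closed: "g \<in> S \<Longrightarrow> gen g \<in> gwords S"
  by (simp add: gen_def gwords_def)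

lemma image_subset_generate:
  "\<phi> ` carrier (presented_group S Rel) \<subseteq> generate H ((\<lambda>g. word_img (gen g)) ` S)"
proof -
  have "word_img w \<in> generate H ((\<lambda>g. word_img (gen g)) ` S)" if "w \<in> gwords S" for w
    using that
  proof (induction w)
    case Nil
    then show ?case
      by (simp add: word_img_Nil generate.one)
  next
    case (Cons x w)
    obtain g b where x: "x = (g, b)"
      by force
    then have g: "g \<in> S" and w: "w \<in> gwords S"
      using Cons.prems by (auto simp: gwords_def)
    have "word_img [x] \<in> generate H ((\<lambda>g. word_img (gen g)) ` S)"
    proof (cases b)
      case True
      then have "[x] = gen g"
        by (simp add: x gen_def)
      then show ?thesis
        using g by (auto intro: generate.incl)
    next
      case False
      then have "[x] = gword_inv (gen g)"
        by (simp add: x gen_def gword_inv_def)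
      then have "word_img [x] = inv (word_img (gen g))"
        using word_img_inv[OF gen_closed[OF g]] by simp
      then show ?thesis
        using g by (auto intro: generate.inv)
    qed
    moreover have "word_img (x # w) = word_img [x] \<otimes> word_img w"
      using word_img_append[of "[x]" w] Cons.prems w by (simp add: gwords_def)
    ultimately show ?case
      using Cons.IH[OF w] by (simp add: generate.eng)
  qed
  then show ?thesis
    unfolding carrier_presented_group word_img_def by blast
qed

end

section \<open>Images of the Steinberg generators and relations\<close>

locale steinberg_hom = group H for H (structure) +
  fixes n :: nat and R :: "('r, 'k) ring_scheme" and \<phi> :: "(nat \<times> nat \<times> 'r) gword set \<Rightarrow> 'a"
  assumes dim: "n \<ge> 3" and ring_R: "ring R" and hom_\<phi>: "\<phi> \<in> hom (steinberg_group n R) H"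
begin

sublocale presented_group_hom H "steinberg_gens n R" "steinberg_rels n R" \<phi>
  using hom_\<phi> by unfold_locales (simp add: steinberg_group_def)

definition root_elem :: "nat \<Rightarrow> nat \<Rightarrow> 'r \<Rightarrow> 'a"
  where "root_elem i j r = word_img (gen (i, j, r))"

definition root_group :: "nat \<Rightarrow> nat \<Rightarrow> 'a set"
  where "root_group i j = root_elem i j ` carrier R"

lemma gen_root_closed:
  "\<lbrakk>i \<in> {1..n}; j \<in> {1..n}; i \<noteq> j; r \<in> carrier R\<rbrakk> \<Longrightarrow> gen (i, j, r) \<in> gwords (steinberg_gens n R)"
  by (intro gen_closed) (simp add: steinberg_gens_def)

lemma root_elem_closed:
  "\<lbrakk>i \<in> {1..n}; j \<in> {1..n}; i \<noteq> j; r \<in> carrier R\<rbrakk> \<Longrightarrow> root_elem i j r \<in> carrier H"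
  unfolding root_elem_def by (intro word_img_closed gen_root_closed)

lemma root_elem_add:
  assumes "i \<in> {1..n}" "j \<in> {1..n}" "i \<noteq> j" "r \<in> carrier R" "s \<in> carrier R"
  shows "root_elem i j (r \<oplus>\<^bsub>R\<^esub> s) = root_elem i j r \<otimes> root_elem i j s"
proof -
  have "(gen (i, j, r) @ gen (i, j, s), gen (i, j, r \<oplus>\<^bsub>R\<^esub> s)) \<in> steinberg_rels n R"
    unfolding steinberg_rels_def using assms by blast
  moreover have "r \<oplus>\<^bsub>R\<^esub> s \<in> carrier R"
    using assms ring_R by (simp add: ring.ring_simprules)
  ultimately have "word_img (gen (i, j, r) @ gen (i, j, s)) = word_img (gen (i, j, r \<oplus>\<^bsub>R\<^esub> s))"
    using assms by (intro word_img_eq pres_eq.rel) (simp_all add: append_gwords_iff gen_root_closed)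
  then show ?thesis
    using assms by (simp add: root_elem_def word_img_append gen_root_closed)
qed

lemma root_elem_comm:
  assumes "i \<in> {1..n}" "j \<in> {1..n}" "k \<in> {1..n}" "i \<noteq> j" "j \<noteq> k" "i \<noteq> k"
    "r \<in> carrier R" "s \<in> carrier R"
  shows "inv (root_elem i j r) \<otimes> inv (root_elem j k s) \<otimes> root_elem i j r \<otimes> root_elem j k s
    = root_elem i k (r \<otimes>\<^bsub>R\<^esub> s)"
proof -
  have "(gword_comm (gen (i, j, r)) (gen (j, k, s)), gen (i, k, r \<otimes>\<^bsub>R\<^esub> s)) \<in> steinberg_rels n R"
    unfolding steinberg_rels_def using assms by blast
  moreover have "r \<otimes>\<^bsub>R\<^esub> s \<in> carrier R"
    using assms ring_R by (simp add: ring.ring_simprules)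
  ultimately have "word_img (gword_comm (gen (i, j, r)) (gen (j, k, s)))
      = word_img (gen (i, k, r \<otimes>\<^bsub>R\<^esub> s))"
    using assms by (intro word_img_eq pres_eq.rel) (simp_all add: gword_comm_closed gen_root_closed)
  then show ?thesis
    using assms by (simp add: root_elem_def word_img_comm gen_root_closed)
qed

lemma root_elem_commute:
  assumes "i \<in> {1..n}" "j \<in> {1..n}" "l \<in> {1..n}" "k \<in> {1..n}" "i \<noteq> j" "l \<noteq> k" "j \<noteq> l" "i \<noteq> k"
    "r \<in> carrier R" "s \<in> carrier R"
  shows "root_elem i j r \<otimes> root_elem l k s = root_elem l k s \<otimes> root_elem i j r"
proof -
  let ?a = "root_elem i j r" and ?b = "root_elem l k s"
  have c: "?a \<in> carrier H" "?b \<in> carrier H"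
    using assms by (simp_all add: root_elem_closed)
  have "(gword_comm (gen (i, j, r)) (gen (l, k, s)), []) \<in> steinberg_rels n R"
    unfolding steinberg_rels_def using assms by blast
  then have "word_img (gword_comm (gen (i, j, r)) (gen (l, k, s))) = word_img []"
    using assms
    by (intro word_img_eq pres_eq.rel) (simp_all add: gword_comm_closed gen_root_closed Nil_closed)
  then have "inv ?a \<otimes> inv ?b \<otimes> ?a \<otimes> ?b = \<one>"
    using assms by (simp add: root_elem_def word_img_comm gen_root_closed word_img_Nil)
  then have "inv (?b \<otimes> ?a) \<otimes> (?a \<otimes> ?b) = \<one>"
    using c by (simp add: inv_mult_group m_assoc)
  then have "inv (?b \<otimes> ?a) = inv (?a \<otimes> ?b)"
    using c by (intro inv_equality[symmetric]) simp_all
  then show ?thesis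
    using c by (metis inv_inv m_closed)
qed

text \<open>By \<open>root_elem_add\<close> it is the image of the additive group of
  \<open>R\<close>: zero goes to an idempotent, hence to the identity, and negatives go to
  inverses.\<close>

lemma subgroup_root_group:
  assumes ij: "i \<in> {1..n}" "j \<in> {1..n}" "i \<noteq> j"
  shows "subgroup (root_group i j) H"
proof -
  interpret R: ring R
    by (rule ring_R)
  have "root_elem i j \<zero>\<^bsub>R\<^esub> \<otimes> root_elem i j \<zero>\<^bsub>R\<^esub> = root_elem i j \<zero>\<^bsub>R\<^esub>"
    using root_elem_add[OF ij, of "\<zero>\<^bsub>R\<^esub>" "\<zero>\<^bsub>R\<^esub>"] by simp
  then have zero: "root_elem i j \<zero>\<^bsub>R\<^esub> = \<one>"
    using root_elem_closed[OF ij, of "\<zero>\<^bsub>R\<^esub>"] by (simp add: r_cancel_one')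
  have inv: "inv (root_elem i j r) = root_elem i j (\<ominus>\<^bsub>R\<^esub> r)" if r: "r \<in> carrier R" for r
  proof (rule inv_equality)
    have "root_elem i j (\<ominus>\<^bsub>R\<^esub> r \<oplus>\<^bsub>R\<^esub> r) = \<one>"
      using r zero by (simp add: R.l_neg)
    then show "root_elem i j (\<ominus>\<^bsub>R\<^esub> r) \<otimes> root_elem i j r = \<one>"
      using root_elem_add[OF ij, of "\<ominus>\<^bsub>R\<^esub> r" r] r by simp
  qed (use ij r in \<open>simp_all add: root_elem_closed\<close>)
  show ?thesis
  proof (rule subgroupI)
    show "root_group i j \<subseteq> carrier H"
      using root_elem_closed[OF ij] by (auto simp: root_group_def)
    show "root_group i j \<noteq> {}"
      using R.zero_closed by (auto simp: root_group_def)
    show "inv a \<in> root_group i j" if "a \<in> root_group i j" for a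
      using that inv by (auto simp: root_group_def)
    show "a \<otimes> b \<in> root_group i j" if ab: "a \<in> root_group i j" "b \<in> root_group i j" for a b
    proof -
      obtain r s where "r \<in> carrier R" "s \<in> carrier R" "a = root_elem i j r" "b = root_elem i j s"
        using ab by (auto simp: root_group_def)
      then show ?thesis
        using root_elem_add[OF ij, of r s] unfolding root_group_def by (metis R.a_closed image_eqI)
    qed
  qed
qed

lemma root_subgroups_root_group: "root_subgroups H n root_group"
proof (intro root_subgroups.intro root_subgroups_axioms.intro)
  show "group H"
    by (rule is_group)
  interpret R: ring R
    by (rule ring_R)
  show "3 \<le> n"
    by (rule dim)
  show "subgroup (root_group i j) H" if "i \<in> {1..n}" "j \<in> {1..n}" "i \<noteq> j" for i j
    using that by (rule subgroup_root_group)
  show "inv a \<otimes> inv b \<otimes> a \<otimes> b \<in> root_group i k"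
    if ijk: "i \<in> {1..n}" "j \<in> {1..n}" "k \<in> {1..n}" "i \<noteq> j" "j \<noteq> k" "i \<noteq> k"
      and ab: "a \<in> root_group i j" "b \<in> root_group j k" for i j k a b
  proof -
    obtain r s where rs: "r \<in> carrier R" "s \<in> carrier R" "a = root_elem i j r" "b = root_elem j k s"
      using ab by (auto simp: root_group_def)
    then show ?thesis
      using root_elem_comm[OF ijk rs(1,2)] by (simp add: root_group_def)
  qed
  show "\<exists>a\<in>root_group i j. \<exists>b\<in>root_group j k. c = inv a \<otimes> inv b \<otimes> a \<otimes> b"
    if ijk: "i \<in> {1..n}" "j \<in> {1..n}" "k \<in> {1..n}" "i \<noteq> j" "j \<noteq> k" "i \<noteq> k"
      and c: "c \<in> root_group i k" for i j k c
  proof -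
    obtain r where r: "r \<in> carrier R" "c = root_elem i k r"
      using c by (auto simp: root_group_def)
    \<comment> \<open>The unit as second argument writes any root element as a commutator.\<close>
    have "c = inv (root_elem i j r) \<otimes> inv (root_elem j k \<one>\<^bsub>R\<^esub>) \<otimes> root_elem i j r
        \<otimes> root_elem j k \<one>\<^bsub>R\<^esub>"
      using root_elem_comm[OF ijk r(1) R.one_closed] r by simp
    moreover have "root_elem i j r \<in> root_group i j" "root_elem j k \<one>\<^bsub>R\<^esub> \<in> root_group j k"
      using r by (simp_all add: root_group_def)
    ultimately show ?thesis
      by blast
  qed
  show "a \<otimes> b = b \<otimes> a"
    if ijlk: "i \<in> {1..n}" "j \<in> {1..n}" "l \<in> {1..n}" "k \<in> {1..n}" "i \<noteq> j" "l \<noteq> k" "j \<noteq> l" "i \<noteq> k"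
      and ab: "a \<in> root_group i j" "b \<in> root_group l k" for i j l k a b
  proof -
    obtain r s where "r \<in> carrier R" "s \<in> carrier R" "a = root_elem i j r" "b = root_elem l k s"
      using ab by (auto simp: root_group_def)
    then show ?thesis
      using root_elem_commute[OF ijlk, of r s] by simp
  qed
qed

end

theorem theorem1p4:
  fixes n k :: nat
    and M :: "'x set" and d :: "'x \<Rightarrow> 'x \<Rightarrow> real"
    and H :: "('h, 'm) monoid_scheme" and \<alpha> :: "'h \<Rightarrow> 'x \<Rightarrow> 'x"
    and \<phi> :: "(nat \<times> nat \<times> (monomial \<Rightarrow>\<^sub>0 int)) gword set \<Rightarrow> 'h"
  assumes "n \<ge> 3"
    and "CAT0_space M d"
    and "group H"
    and "isometric_action H M d \<alpha>"
    and "proper_action H M d \<alpha>"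
    and "cocompact_action H M d \<alpha>"
    and "faithful_action H M \<alpha>"
    and "\<phi> \<in> hom (steinberg_group n (free_assoc_ring k)) H"
  shows "finite (\<phi> ` carrier (steinberg_group n (free_assoc_ring k)))"
proof (cases "M = {}")
  case True
  interpret faithful_action H M \<alpha>
    by fact
  \<comment> \<open>The only extensional map on the empty set is
    \<open>\<lambda>x. undefined\<close>, so faithfulness leaves at most one element in
    \<open>H\<close>. The geometric argument needs a base point.\<close>
  have "\<alpha> ` carrier H \<subseteq> {\<lambda>x. undefined}"
    using bij_prop0 Bij_imp_extensional[of _ "{}"] True by fastforce
  then have "finite (carrier H)"
    by (intro finite_imageD[OF _ faithful]) (auto intro: finite_subset)
  moreover have "\<phi> ` carrier (steinberg_group n (free_assoc_ring k)) \<subseteq> carrier H"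
    using assms(8) by (auto simp: hom_def)
  ultimately show ?thesis
    by (rule rev_finite_subset)
next
  case False
  interpret geometric_action M d H \<alpha>
    using assms by (intro geometric_action.intro isometric_group_action.intro
      isometric_group_action_axioms.intro geometric_action_axioms.intro) (auto simp: CAT0_space_def)
  interpret steinberg_hom H n "free_assoc_ring k" \<phi>
    using assms(1,8) ring_free_assoc_ring is_group
    by (intro steinberg_hom.intro steinberg_hom_axioms.intro)
  interpret U: finite_root_subgroups H n root_group
    by (rule finite_root_subgroups[OF False root_subgroups_root_group])
  \<comment> \<open>The images of the Steinberg generators are exactly the elements of the root
    groups, so the image of \<phi> lies in their span.\<close>
  have "(\<lambda>g. word_img (gen g)) ` steinberg_gens n (free_assoc_ring k) = U.elems U.roots"
    unfolding U.elems_def U.roots_def root_group_def root_elem_def steinberg_gens_def by force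
  then have "\<phi> ` carrier (steinberg_group n (free_assoc_ring k)) \<subseteq> U.root_span U.roots"
    using image_subset_generate by (simp add: steinberg_group_def U.root_span_def)
  then show ?thesis
    using U.finite_root_span by (rule finite_subset)
qed

end
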